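(* For any constant $\varepsilon \in (0,1)$ and integer constant $t\ge 2$, there exist edge-weighted trees for which any $(t-\varepsilon)$-spanner using $k < n$ Steiner points has complexity $\Omega\big(mn^{1/(t+1)}/k^{1/(t+1)}\big)$. Precisely: for every $\varepsilon\in(0,1)$ and every integer $t\ge 2$ there are constants $c, C>0$ such that for all positive integers $n,m,k$ with $k<n$ and $m\ge Cn$ there is an edge-weighted rooted tree $T$ with $n$ leaves and $m$ vertices such that every $(t-\varepsilon)$-spanner for $T$ using $k$ Steiner points has complexity at least $c\, mn^{1/(t+1)}/k^{1/(t+1)}$.
   Context: Let $T$ be a rooted tree with positive edge weights; the sites $S$ are its leaves. The distance $d(p,q)$ between two points of $T$ is the total weight of the unique path $\pi(p,q)$ between them. A Steiner point may be any vertex of $T$ or a point in the interior of an edge; placing a Steiner point $s$ in the interior of an edge $(u,v)$ of weight $w$ replaces this edge by edges $(u,s)$ and $(s,v)$ of weights $\delta w$ and $(1-\delta)w$ for some $\delta\in(0,1)$. A spanner for $T$ with Steiner point set $\mathcal{S}$ is a graph $\mathcal{G}$ with vertex set $S\cup\mathcal{S}$; its edges are called links. A link $(p,q)$ represents the path $\pi(p,q)$: its length is $d(p,q)$ and its complexity is the number of edges of $\pi(p,q)$. $\mathcal{G}$ is a $\tau$-spanner if $d_{\mathcal{G}}(p,q)\le \tau\, d(p,q)$ for all sites $p,q\in S$, where $d_{\mathcal G}$ is the shortest-path distance in $\mathcal{G}$ (no requirement is made for distances involving Steiner points). The complexity of $\mathcal{G}$ is the sum of the complexities of its links. *)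

theory Defs
  imports Complex_Main "Graph_Theory.Graph_Theory"
begin

text \<open>
  Finite simple undirected graphs are the symmetric digraphs of the locale \<open>pair_graph\<close>:
  an undirected edge between \<open>u\<close> and \<open>v\<close> is the pair of arcs \<open>(u,v)\<close>, \<open>(v,u)\<close>.
  The constant \<open>Digraph_Component.tree\<close> cannot be used for them, since there the closed
  walk \<open>u, v, u\<close> counts as a cycle.
\<close>

definition undirected_tree :: "'a pair_pre_digraph \<Rightarrow> bool" where
  "undirected_tree G \<longleftrightarrow> pair_graph G \<and> pverts G \<noteq> {} \<and>
     (\<forall>u\<in>pverts G. \<forall>v\<in>pverts G. \<exists>!p. pre_digraph.apath (with_proj G) u p v)"

record 'a rtree =
  tgraph :: "'a pair_pre_digraph"
  troot :: 'a
  wgt :: "('a \<times> 'a) weight_fun"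

definition weighted_rooted_tree :: "'a rtree \<Rightarrow> bool" where
  "weighted_rooted_tree T \<longleftrightarrow> undirected_tree (tgraph T) \<and> troot T \<in> pverts (tgraph T) \<and>
     (\<forall>(u,v)\<in>parcs (tgraph T). 0 < wgt T (u,v) \<and> wgt T (v,u) = wgt T (u,v))"

definition tpath :: "'a rtree \<Rightarrow> 'a \<Rightarrow> 'a \<Rightarrow> ('a \<times> 'a) awalk" where
  "tpath T u v = (THE p. pre_digraph.apath (with_proj (tgraph T)) u p v)"

definition tdist :: "'a rtree \<Rightarrow> 'a \<Rightarrow> 'a \<Rightarrow> real" where
  "tdist T u v = sum_list (map (wgt T) (tpath T u v))"

definition children :: "'a rtree \<Rightarrow> 'a \<Rightarrow> 'a set" where
  "children T u = {v \<in> pverts (tgraph T). (u,v) \<in> set (tpath T (troot T) v)}"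

text \<open>A root of degree one is not a leaf, unlike in an unrooted tree.\<close>

definition leaves :: "'a rtree \<Rightarrow> 'a set" where
  "leaves T = {u \<in> pverts (tgraph T). children T u = {}}"

definition subdivide_edge :: "'a rtree \<Rightarrow> 'a \<Rightarrow> 'a \<Rightarrow> 'a \<Rightarrow> real \<Rightarrow> 'a rtree" where
  "subdivide_edge T u v s \<delta> = T\<lparr>
     tgraph := subdivide (tgraph T) (u,v) s,
     wgt := (wgt T)(
       (u,s) := \<delta> * wgt T (u,v), (s,u) := \<delta> * wgt T (u,v),
       (s,v) := (1 - \<delta>) * wgt T (u,v), (v,s) := (1 - \<delta>) * wgt T (u,v))\<rparr>"

text \<open>
  \<open>steiner_placement T A T'\<close>: placing the Steiner points \<open>A\<close> in \<open>T\<close> turns it into \<open>T'\<close>.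
  The edge that is subdivided may itself stem from an earlier subdivision, so that several
  Steiner points can lie on one edge of \<open>T\<close>.
\<close>

inductive steiner_placement :: "'a rtree \<Rightarrow> 'a set \<Rightarrow> 'a rtree \<Rightarrow> bool" for T where
  none: "steiner_placement T {} T"
| at_vertex: "\<lbrakk>steiner_placement T A T'; s \<in> pverts (tgraph T)\<rbrakk>
    \<Longrightarrow> steiner_placement T (insert s A) T'"
| on_edge: "\<lbrakk>steiner_placement T A T'; (u,v) \<in> parcs (tgraph T'); s \<notin> pverts (tgraph T');
     0 < \<delta>; \<delta> < 1\<rbrakk>
    \<Longrightarrow> steiner_placement T (insert s A) (subdivide_edge T' u v s \<delta>)"

text \<open>
  \<open>steiner_spanner \<tau> T A T' G\<close>: \<open>G\<close> is a \<open>\<tau>\<close>-spanner for \<open>T\<close> with Steiner points \<open>A\<close>,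
  whose placement yields \<open>T'\<close>. The shortest-path distance \<open>wf_digraph.\<mu>\<close> is \<open>\<infinity>\<close> between
  vertices in different components.
\<close>

definition steiner_spanner ::
    "real \<Rightarrow> 'a rtree \<Rightarrow> 'a set \<Rightarrow> 'a rtree \<Rightarrow> 'a pair_pre_digraph \<Rightarrow> bool" where
  "steiner_spanner \<tau> T A T' G \<longleftrightarrow>
     steiner_placement T A T' \<and> pair_graph G \<and> pverts G = leaves T \<union> A \<and>
     (\<forall>p\<in>leaves T. \<forall>q\<in>leaves T.
        wf_digraph.\<mu> (with_proj G) (\<lambda>(x,y). tdist T' x y) p q \<le> ereal (\<tau> * tdist T' p q))"

text \<open>Each link of \<open>G\<close> consists of two arcs, hence the division by two.\<close>

definition complexity :: "'a rtree \<Rightarrow> 'a pair_pre_digraph \<Rightarrow> real" where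
  "complexity T' G = real (\<Sum>(p,q)\<in>parcs G. length (tpath T' p q)) / 2"

end

theory Submission
  imports Defs
begin

text \<open>
  The tree is a caterpillar. Its leaves hang by edges of weight \<open>1\<close> from a spine, with \<open>M \<approx> m/n\<close>
  spine edges between consecutive leaves, and they form \<open>2k\<close> groups of \<open>N \<approx> n/(2k)\<close> consecutive
  leaves. The spine edges between different groups have weight \<open>4t\<close>, all others a tiny weight.
  At least \<open>k\<close> of the groups have no Steiner point within distance \<open>2t\<close>. Two leaves of such
  a group have distance nearly \<open>2\<close>, every link inside the group has length at least \<open>2\<close>, and every
  link leaving it has length at least \<open>2t\<close>; so the spanner joins any two of its leaves by fewer
  than \<open>t\<close> links inside the group. Few hops are expensive: the index differences of these links sum
  up to at least a constant times \<open>N \<cdot> N powr (1/(t-1))\<close>, and a link of index difference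
  \<open>\<delta>\<close> has complexity at least \<open>M \<delta>\<close>. Summing over the groups gives the bound. If \<open>n/k\<close> is bounded,
  it suffices that the path between the first and the last leaf has about \<open>m\<close> edges.
\<close>

section \<open>Links with few hops\<close>

text \<open>Used for sets of arcs: among the links of a group both directions of a link are present
  and count, which is why such sums are later compared with twice the complexity.\<close>

definition span_length :: "(nat \<times> nat) set \<Rightarrow> real" where
  "span_length E = (\<Sum>(a,b)\<in>E. \<bar>real a - real b\<bar>)"

lemma span_length_nonneg: "0 \<le> span_length E"
  unfolding span_length_def by (intro sum_nonneg) auto

text \<open>Only hops on walks from \<open>x\<close> have to be short: in the counting argument
  below long links may well exist, but out of reach of \<open>x\<close>.\<close>

lemma relpow_displacement:
  fixes E :: "(nat \<times> nat) set" and \<rho> :: real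
  assumes "(x,v) \<in> E ^^ i"
    and "\<And>i' a b. i' < i \<Longrightarrow> (x,a) \<in> E ^^ i' \<Longrightarrow> (a,b) \<in> E \<Longrightarrow> \<bar>real a - real b\<bar> \<le> \<rho>"
  shows "\<bar>real x - real v\<bar> \<le> real i * \<rho>"
  using assms
proof (induction i arbitrary: v)
  case (Suc i)
  from Suc.prems(1) obtain a where a: "(x,a) \<in> E ^^ i" "(a,v) \<in> E" by auto
  have "\<bar>real x - real a\<bar> \<le> real i * \<rho>"
    using Suc.IH[OF a(1)] Suc.prems(2) less_SucI by blast
  moreover have "\<bar>real a - real v\<bar> \<le> \<rho>" using Suc.prems(2)[of i a v] a by simp
  ultimately show ?case by (simp add: algebra_simps)
qed simp

lemma card_near_le:
  fixes r :: real
  assumes "0 \<le> r"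
  shows "card {x::nat. \<bar>real x - real v\<bar> < r} \<le> 2 * r + 1"
proof -
  define a where "a = nat \<lceil>real v - r\<rceil>"
  define b where "b = nat \<lfloor>real v + r\<rfloor>"
  have "{x::nat. \<bar>real x - real v\<bar> < r} \<subseteq> {a..b}"
    unfolding a_def b_def by (auto; linarith)
  then have "card {x::nat. \<bar>real x - real v\<bar> < r} \<le> card {a..b}"
    by (rule card_mono[rotated]) simp
  moreover have "real (Suc b - a) \<le> 2 * r + 1"
    using assms unfolding a_def b_def by linarith
  ultimately show ?thesis by simp
qed

text \<open>Let \<open>r\<close> be the quotient in the statement. At most \<open>2 * r + 1\<close>
  points are closer than \<open>r\<close> to a given point of \<open>V\<close>, hence at most
  \<open>card X / 2 + card V\<close> points are close to \<open>V\<close>. By the last hypothesis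
  this is at most three quarters of \<open>card X\<close>.\<close>

lemma card_far_ge:
  fixes X V :: "nat set"
  assumes "finite X" "finite V" "V \<noteq> {}" "4 * card V \<le> card X"
  shows "card X \<le> 4 * card {x\<in>X. \<forall>v\<in>V. real (card X) / (4 * real (card V)) \<le> \<bar>real x - real v\<bar>}"
proof -
  define r where "r = real (card X) / (4 * real (card V))"
  let ?F = "{x\<in>X. \<forall>v\<in>V. r \<le> \<bar>real x - real v\<bar>}"
  let ?N = "\<lambda>v. {x::nat. \<bar>real x - real v\<bar> < r}"
  have v: "card V > 0" using assms by (simp add: card_gt_0_iff)
  have r: "0 \<le> r" by (simp add: r_def)
  have fin: "finite (?N v)" for v
  proof -
    have "?N v \<subseteq> {..nat \<lceil>real v + r\<rceil>}" by (auto; linarith)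
    then show ?thesis by (rule finite_subset) simp
  qed
  have "X \<subseteq> ?F \<union> (\<Union>v\<in>V. ?N v)" by force
  then have "card X \<le> card (?F \<union> (\<Union>v\<in>V. ?N v))"
    using assms fin by (intro card_mono) auto
  also have "\<dots> \<le> card ?F + card (\<Union>v\<in>V. ?N v)" by (rule card_Un_le)
  also have "card (\<Union>v\<in>V. ?N v) \<le> (\<Sum>v\<in>V. card (?N v))"
    using assms by (intro card_UN_le) auto
  finally have "real (card X) \<le> real (card ?F) + (\<Sum>v\<in>V. real (card (?N v)))"
    by (simp flip: of_nat_sum of_nat_add)
  also have "(\<Sum>v\<in>V. real (card (?N v))) \<le> (\<Sum>v\<in>V. 2 * r + 1)"
    using card_near_le[OF r] by (intro sum_mono) auto
  also have "\<dots> = 2 * (r * real (card V)) + real (card V)" by (simp add: algebra_simps)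
  also have "r * real (card V) = real (card X) / 4" using v by (simp add: r_def)
  finally show ?thesis using assms(4) unfolding r_def by linarith
qed

text \<open>
  With \<open>n = card X\<close>, \<open>v = card V\<close> and \<open>r = n / (4 * v)\<close>, at least a quarter of \<open>X\<close> has distance
  at least \<open>r\<close> from \<open>V\<close>. A walk of \<open>j + 1\<close> hops from such a point uses a link of span at least
  \<open>r / (j + 1)\<close>, hence reaches the tail of such a link within \<open>j\<close> hops. There are at most
  \<open>(j + 1) * W / r\<close> of these tails, where \<open>W\<close> is the total span, and they replace \<open>V\<close> in the
  induction hypothesis.
\<close>

lemma few_hops_span_length:
  "\<exists>K>0. \<forall>(E::(nat \<times> nat) set) X V. finite E \<longrightarrow> finite X \<longrightarrow> finite V \<longrightarrow>
     (\<forall>x\<in>X. \<exists>v\<in>V. \<exists>i\<le>j. (x,v) \<in> E ^^ i) \<longrightarrow>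
     real (card X) ^ Suc j \<le> K * (span_length E + real (card X)) ^ j * real (card V)"
proof (induction j)
  case 0
  have "card X \<le> card V" if "finite V" "\<forall>x\<in>X. \<exists>v\<in>V. (x,v) \<in> E ^^ 0"
    for E :: "(nat \<times> nat) set" and X V
    using that by (intro card_mono) auto
  then show ?case by (intro exI[of _ 1]) auto
next
  case (Suc j)
  then obtain K where K: "K > 0" and IH: "\<And>(E::(nat \<times> nat) set) X V. finite E \<Longrightarrow> finite X \<Longrightarrow>
     finite V \<Longrightarrow> (\<forall>x\<in>X. \<exists>v\<in>V. \<exists>i\<le>j. (x,v) \<in> E ^^ i) \<Longrightarrow>
     real (card X) ^ Suc j \<le> K * (span_length E + real (card X)) ^ j * real (card V)"
    by blast
  \<comment> \<open>The summand \<open>4\<close> settles the case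
    \<open>card X < 4 * card V\<close>. In the main case, \<open>j + 1\<close> factors
    \<open>4\<close> come from passing from \<open>X\<close> to \<open>X'\<close> inside a power,
    one more from \<open>r\<close>, and \<open>Suc j\<close> from the number of tails.\<close>
  define K' where "K' = 4 + K * 4 ^ (j + 2) * real (Suc j)"
  have K'_ge: "4 \<le> K'" "K * 4 ^ (j + 2) * real (Suc j) \<le> K'" using K by (auto simp: K'_def)
  show ?case
  proof (intro exI[of _ K'] conjI allI impI)
    show "0 < K'" using K'_ge by simp
    fix E :: "(nat \<times> nat) set" and X V
    assume fin: "finite E" "finite X" "finite V"
      and reach: "\<forall>x\<in>X. \<exists>v\<in>V. \<exists>i\<le>Suc j. (x,v) \<in> E ^^ i"
    define n where "n = real (card X)"
    define v where "v = real (card V)"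
    define W where "W = span_length E"
    have W: "0 \<le> W" by (simp add: W_def span_length_nonneg)
    have n0: "0 \<le> n" and v0: "0 \<le> v" by (auto simp: n_def v_def)
    have "n ^ Suc (Suc j) \<le> K' * (W + n) ^ Suc j * v"
    proof (cases "4 * card V \<le> card X")
      case False
      then have "n \<le> 4 * v" by (simp add: n_def v_def)
      have "n ^ Suc (Suc j) = n ^ Suc j * n" by simp
      also have "\<dots> \<le> (W + n) ^ Suc j * (4 * v)"
        using W n0 v0 \<open>n \<le> 4 * v\<close> by (intro mult_mono power_mono) auto
      also have "\<dots> = 4 * (W + n) ^ Suc j * v" by simp
      also have "\<dots> \<le> K' * (W + n) ^ Suc j * v"
        using K'_ge W n0 v0 by (intro mult_right_mono) auto
      finally show ?thesis .
    next
      case True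
      show ?thesis
      proof (cases "X = {}")
        case True
        then show ?thesis using W v0 K'_ge by (simp add: n_def)
      next
        case False
        then have npos: "0 < n" using fin by (simp add: n_def card_gt_0_iff)
        have "V \<noteq> {}" using False reach by auto
        then have vpos: "0 < v" using fin by (simp add: v_def card_gt_0_iff)
        define r where "r = n / (4 * v)"
        have rpos: "0 < r" using npos vpos by (simp add: r_def)
        define X' where "X' = {x\<in>X. \<forall>v\<in>V. r \<le> \<bar>real x - real v\<bar>}"
        have X'_big: "n \<le> 4 * real (card X')"
          using card_far_ge[OF fin(2,3) \<open>V \<noteq> {}\<close> True] unfolding X'_def r_def n_def v_def by linarith
        have X'_le: "real (card X') \<le> n" unfolding n_def X'_def using fin by (simp add: card_mono)
        define L where "L = {(a,b)\<in>E. r \<le> real (Suc j) * \<bar>real a - real b\<bar>}"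
        have finL: "finite L" using fin by (auto simp: L_def intro: finite_subset)
        have "r * real (card L) = (\<Sum>(a,b)\<in>L. r)" by (simp add: case_prod_unfold)
        also have "\<dots> \<le> (\<Sum>(a,b)\<in>L. real (Suc j) * \<bar>real a - real b\<bar>)"
          by (intro sum_mono) (auto simp: L_def)
        also have "\<dots> = real (Suc j) * (\<Sum>(a,b)\<in>L. \<bar>real a - real b\<bar>)"
          by (simp add: sum_distrib_left case_prod_unfold)
        also have "\<dots> \<le> real (Suc j) * W"
          unfolding W_def span_length_def using fin
          by (intro mult_left_mono sum_mono2) (auto simp: L_def)
        finally have rL: "r * real (card L) \<le> real (Suc j) * W" .
        have "card (fst ` L) \<le> card L" using finL by (rule card_image_le)
        then have rV: "r * real (card (fst ` L)) \<le> real (Suc j) * W"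
          using rL rpos by (smt (verit) mult_left_mono of_nat_mono)
        have reach': "\<forall>x\<in>X'. \<exists>a\<in>fst ` L. \<exists>i\<le>j. (x,a) \<in> E ^^ i"
        proof
          fix x assume x: "x \<in> X'"
          then obtain v i where v: "v \<in> V" "i \<le> Suc j" "(x,v) \<in> E ^^ i" "r \<le> \<bar>real x - real v\<bar>"
            using reach by (auto simp: X'_def)
          show "\<exists>a\<in>fst ` L. \<exists>i\<le>j. (x,a) \<in> E ^^ i"
          proof (rule ccontr)
            assume none: "\<not> ?thesis"
            let ?d = "\<lambda>a b. \<bar>real a - real b\<bar>"
            define S where "S = {(a,b)\<in>E. real (Suc j) * ?d a b < r}"
            \<comment> \<open>The maximum over finitely many short links turns their strict bounds
              into a single strict one, which is needed since \<open>x\<close> may have distance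
              exactly \<open>r\<close> from \<open>v\<close>. The inserted \<open>0\<close> covers
              the absence of short links.\<close>
            define \<rho> where "\<rho> = Max (insert 0 ((\<lambda>(a,b). ?d a b) ` S))"
            have finS: "finite S" using fin by (auto simp: S_def intro: finite_subset)
            have "\<rho> \<in> insert 0 ((\<lambda>(a,b). ?d a b) ` S)"
              unfolding \<rho>_def using finS by (intro Max_in) auto
            then have \<rho>: "real (Suc j) * \<rho> < r" "0 \<le> \<rho>" using rpos by (auto simp: S_def)
            have "?d a b \<le> \<rho>" if "i' < i" "(x,a) \<in> E ^^ i'" "(a,b) \<in> E" for i' a b
            proof -
              \<comment> \<open>Since \<open>i' < i\<close> and \<open>i \<le> Suc j\<close>, a long
                link here would have its tail within \<open>j\<close> hops of \<open>x\<close>,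
                contrary to \<open>none\<close>.\<close>
              have "(a,b) \<notin> L"
                using none that v(2) by (force simp: image_iff)
              then have "(a,b) \<in> S" using that by (auto simp: S_def L_def)
              then show ?thesis unfolding \<rho>_def using finS by (intro Max_ge) auto
            qed
            then have "?d x v \<le> real i * \<rho>" using relpow_displacement[OF v(3)] by blast
            also have "\<dots> \<le> real (Suc j) * \<rho>" using v(2) \<rho> by (intro mult_right_mono) auto
            finally show False using v(4) \<rho> by linarith
          qed
        qed
        have finX': "finite X'" using fin by (simp add: X'_def)
        have "real (card X') ^ Suc j \<le> K * (W + real (card X')) ^ j * real (card (fst ` L))"
          using IH[OF fin(1) finX' _ reach'] finL by (simp add: W_def)
        also have "\<dots> \<le> K * (W + n) ^ j * real (card (fst ` L))"
          using K W X'_le by (intro mult_right_mono mult_left_mono power_mono) auto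
        finally have *: "real (card X') ^ Suc j \<le> K * (W + n) ^ j * real (card (fst ` L))" .
        have "n ^ Suc j \<le> (4 * real (card X')) ^ Suc j"
          using X'_big n0 by (rule power_mono)
        also have "\<dots> \<le> 4 ^ Suc j * (K * (W + n) ^ j * real (card (fst ` L)))"
          using * by (simp only: power_mult_distrib) simp
        finally have "n ^ Suc j * r \<le> 4 ^ Suc j * K * (W + n) ^ j * (r * real (card (fst ` L)))"
          using rpos by (simp add: mult.commute mult.left_commute)
        also have "\<dots> \<le> 4 ^ Suc j * K * (W + n) ^ j * (real (Suc j) * W)"
          using rV K W n0 by (intro mult_left_mono) auto
        also have "\<dots> \<le> 4 ^ Suc j * K * (W + n) ^ j * (real (Suc j) * (W + n))"
          using K W n0 by (intro mult_left_mono) auto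
        finally have "n ^ Suc j * n \<le> 4 ^ Suc j * K * (W + n) ^ j * (real (Suc j) * (W + n)) * (4 * v)"
          using vpos by (simp add: r_def field_simps)
        also have "\<dots> = K * 4 ^ (j + 2) * real (Suc j) * ((W + n) ^ Suc j * v)"
          by (simp add: power_add algebra_simps)
        also have "\<dots> \<le> K' * ((W + n) ^ Suc j * v)"
          using K'_ge W n0 v0 by (intro mult_right_mono) auto
        finally show ?thesis by (simp add: mult_ac)
      qed
    qed
    then show "real (card X) ^ Suc (Suc j)
        \<le> K' * (span_length E + real (card X)) ^ Suc j * real (card V)"
      by (simp add: n_def v_def W_def)
  qed
qed

section \<open>Trees as cut systems\<close>

text \<open>
  \<open>c (a,b)\<close> is the side of \<open>b\<close> when the edge between \<open>a\<close> and \<open>b\<close> is removed. Its existence for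
  every edge makes a connected graph a tree, and the path from \<open>u\<close> to \<open>v\<close> consists of the arcs
  whose cut separates \<open>u\<close> from \<open>v\<close>; so both \<open>tdist\<close> and the number of edges are cut metrics.
\<close>

definition cut_system :: "('a \<times> 'a) set \<Rightarrow> ('a \<times> 'a \<Rightarrow> 'a set) \<Rightarrow> bool" where
  "cut_system E c \<longleftrightarrow> (\<forall>a b. (a,b) \<in> E \<longrightarrow> a \<notin> c (a,b) \<and> b \<in> c (a,b) \<and> c (b,a) = - c (a,b) \<and>
     (\<forall>x y. (x,y) \<in> E \<longrightarrow> (x,y) \<noteq> (a,b) \<longrightarrow> (x,y) \<noteq> (b,a) \<longrightarrow> (x \<in> c (a,b) \<longleftrightarrow> y \<in> c (a,b))))"

lemma cut_systemD:
  assumes "cut_system E c" "(a,b) \<in> E"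
  shows "a \<notin> c (a,b)" "b \<in> c (a,b)" "c (b,a) = - c (a,b)"
    and "(x,y) \<in> E \<Longrightarrow> (x,y) \<noteq> (a,b) \<Longrightarrow> (x,y) \<noteq> (b,a) \<Longrightarrow> x \<in> c (a,b) \<longleftrightarrow> y \<in> c (a,b)"
  using assms unfolding cut_system_def by blast+

definition separating :: "('a \<times> 'a) set \<Rightarrow> ('a \<times> 'a \<Rightarrow> 'a set) \<Rightarrow> 'a \<Rightarrow> 'a \<Rightarrow> ('a \<times> 'a) set" where
  "separating E c u v = {e \<in> E. u \<notin> c e \<and> v \<in> c e}"

text \<open>Induction on the path. Only the cuts of its first edge \<open>(u,x)\<close> tell
  \<open>u\<close> from \<open>x\<close>, so the arcs separating \<open>u\<close> from
  \<open>v\<close> and those separating \<open>x\<close> from \<open>v\<close> can differ only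
  there. A simple path never returns to \<open>u\<close>; hence \<open>(x,u)\<close> is not among
  the latter, and \<open>v\<close> lies on the side of \<open>x\<close>.\<close>

lemma (in pair_graph) apath_eq_separating:
  assumes "cut_system (parcs G) c" and "apath u p v"
  shows "set p = separating (parcs G) c u v"
  using assms(2)
proof (induction p arbitrary: u)
  case Nil
  then show ?case by (auto simp: apath_simps separating_def)
next
  case (Cons e p)
  obtain x where e: "e = (u,x)" using Cons.prems by (cases e) (auto simp: apath_simps)
  have ux: "(u,x) \<in> parcs G" and p: "apath x p v" and u: "u \<notin> set (awalk_verts x p)"
    using Cons.prems by (auto simp: e apath_simps)
  have IH: "set p = separating (parcs G) c x v" using Cons.IH[OF p] .
  have xu: "(x,u) \<in> parcs G" using ux arcs_symmetric by blast
  have np: "(u,x) \<notin> set p" "(x,u) \<notin> set p"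
    using u p awalk_verts_arc1[of "(u,x)" p x] awalk_verts_arc2[of x p v "(x,u)"]
    by (auto simp: apath_def)
  have c: "u \<notin> c (u,x)" "x \<in> c (u,x)" "c (x,u) = - c (u,x)"
    using cut_systemD[OF assms(1) ux] by auto
  have v: "v \<in> c (u,x)"
    using np(2) c xu unfolding IH separating_def by auto
  have other: "f \<in> separating (parcs G) c u v \<longleftrightarrow> f \<in> set p"
    if "f \<noteq> (u,x)" "f \<noteq> (x,u)" for f
  proof -
    obtain a b where f: "f = (a,b)" by (cases f)
    show ?thesis
      using cut_systemD(4)[OF assms(1) _ ux, of a b] that unfolding f IH separating_def by auto
  qed
  have ux_sep: "(u,x) \<in> separating (parcs G) c u v" "(x,u) \<notin> separating (parcs G) c u v"
    using ux c v by (auto simp: separating_def)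
  show ?case
  proof (rule set_eqI)
    fix f
    consider "f = (u,x)" | "f = (x,u)" "f \<noteq> (u,x)" | "f \<noteq> (u,x)" "f \<noteq> (x,u)" by blast
    then show "f \<in> set (e # p) \<longleftrightarrow> f \<in> separating (parcs G) c u v"
    proof cases
      case 1
      then show ?thesis using ux_sep(1) by (simp add: e)
    next
      case 2
      then show ?thesis using np(2) ux_sep(2) by (simp add: e)
    next
      case 3
      then show ?thesis using other[OF 3] by (simp add: e)
    qed
  qed
qed

text \<open>On a simple path from \<open>u\<close> the first arc is the only one with tail
  \<open>u\<close>. So the set of arcs determines it, and then in turn the rest.\<close>

lemma (in pair_wf_digraph) apath_determined_by_set:
  assumes "apath u p v" "apath u q v" "set p = set q"
  shows "p = q"
  using assms
proof (induction p arbitrary: u q)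
  case (Cons e p)
  obtain f q' where q: "q = f # q'" using Cons.prems by (cases q) auto
  have "fst e = u" "fst f = u" using Cons.prems by (auto simp: q apath_simps)
  have "e \<notin> set q'"
    using awalk_verts_arc1[of e q' "snd f"] Cons.prems \<open>fst e = u\<close> \<open>fst f = u\<close>
    by (auto simp: q apath_simps)
  then have ef: "e = f" using Cons.prems(3) by (auto simp: q)
  have "e \<notin> set p"
    using awalk_verts_arc1[of e p "snd e"] Cons.prems \<open>fst e = u\<close> by (auto simp: apath_simps)
  then have "set p = set q'" using Cons.prems(3) \<open>e \<notin> set q'\<close> by (auto simp: q ef)
  then show ?case using Cons.IH[of "snd e" q'] Cons.prems by (auto simp: q ef apath_simps)
qed auto

text \<open>The cuts take the place of acyclicity: they can be written down explicitly for a
  caterpillar and be carried along a subdivision.\<close>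

locale cut_tree =
  fixes T :: "'a rtree" and c :: "'a \<times> 'a \<Rightarrow> 'a set"
  assumes graph: "pair_graph (tgraph T)"
    and connected: "\<And>u v. u \<in> pverts (tgraph T) \<Longrightarrow> v \<in> pverts (tgraph T) \<Longrightarrow> (u,v) \<in> (parcs (tgraph T))\<^sup>*"
    and cuts: "cut_system (parcs (tgraph T)) c"
    and wgt_pos: "\<And>u v. (u,v) \<in> parcs (tgraph T) \<Longrightarrow> 0 < wgt T (u,v)"
    and wgt_sym: "\<And>u v. (u,v) \<in> parcs (tgraph T) \<Longrightarrow> wgt T (v,u) = wgt T (u,v)"
begin

abbreviation "V \<equiv> pverts (tgraph T)"
abbreviation "E \<equiv> parcs (tgraph T)"
abbreviation "sep \<equiv> separating E c"

sublocale pair_graph "tgraph T" by (rule graph)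

lemma ex1_apath:
  assumes "u \<in> V" "v \<in> V"
  shows "\<exists>!p. apath u p v"
proof -
  have "(u,v) \<in> E\<^sup>*" using connected assms by blast
  then have "\<exists>p. awalk u p v"
  proof (induction rule: converse_rtrancl_induct)
    case base
    show ?case using assms awalk_Nil_iff by blast
  next
    case (step y z)
    then obtain p where "awalk z p v" by blast
    then have "awalk y ((y,z) # p) v" using step by (simp add: awalk_Cons_iff)
    then show ?case by blast
  qed
  then have "\<exists>p. apath u p v" using apath_awalk_to_apath by blast
  moreover have "p = q" if "apath u p v" "apath u q v" for p q
    using apath_determined_by_set[OF that] apath_eq_separating[OF cuts] that by simp
  ultimately show ?thesis by blast
qed

lemma undirected_tree: "V \<noteq> {} \<Longrightarrow> undirected_tree (tgraph T)"
  unfolding undirected_tree_def using graph ex1_apath by blast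

lemma tpath:
  assumes "u \<in> V" "v \<in> V"
  shows "set (tpath T u v) = sep u v" and "distinct (tpath T u v)"
proof -
  have p: "apath u (tpath T u v) v"
    unfolding tpath_def using theI'[OF ex1_apath[OF assms]] .
  show "set (tpath T u v) = sep u v" using apath_eq_separating[OF cuts p] .
  show "distinct (tpath T u v)" using p distinct_verts_imp_distinct by (auto simp: apath_def)
qed

section \<open>Distance and number of edges as cut metrics\<close>

lemma finite_sep: "finite (sep u v)"
  using pair_finite_arcs by (simp add: separating_def)

lemma tdist_eq: "u \<in> V \<Longrightarrow> v \<in> V \<Longrightarrow> tdist T u v = sum (wgt T) (sep u v)"
  unfolding tdist_def using tpath sum_list_distinct_conv_sum_set by metis

lemma length_tpath: "u \<in> V \<Longrightarrow> v \<in> V \<Longrightarrow> length (tpath T u v) = card (sep u v)"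
  using tpath distinct_card by metis

lemma wgt_sep_pos: "e \<in> sep u v \<Longrightarrow> 0 < wgt T e"
  using wgt_pos by (cases e) (auto simp: separating_def)

lemma tdist_nonneg: "u \<in> V \<Longrightarrow> v \<in> V \<Longrightarrow> 0 \<le> tdist T u v"
  by (simp add: tdist_eq sum_nonneg wgt_sep_pos less_imp_le)

text \<open>The vertex \<open>v\<close> is on one of the two sides of each cut between
  \<open>u\<close> and \<open>w\<close>. Both triangle inequalities come from this.\<close>

lemma sep_triangle: "sep u w \<subseteq> sep u v \<union> sep v w"
  by (auto simp: separating_def)

lemma tdist_triangle:
  assumes "u \<in> V" "v \<in> V" "w \<in> V"
  shows "tdist T u w \<le> tdist T u v + tdist T v w"
proof -
  have "sum (wgt T) (sep u w) \<le> sum (wgt T) (sep u v \<union> sep v w)"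
    using sep_triangle[of u w v] finite_sep by (intro sum_mono2) (auto intro: less_imp_le wgt_sep_pos)
  also have "\<dots> \<le> sum (wgt T) (sep u v) + sum (wgt T) (sep v w)"
  proof -
    have "0 \<le> sum (wgt T) (sep u v \<inter> sep v w)"
      by (intro sum_nonneg) (auto intro: less_imp_le wgt_sep_pos)
    then show ?thesis
      using sum.union_inter[OF finite_sep finite_sep, of "wgt T" u v v w] by linarith
  qed
  finally show ?thesis using assms by (simp add: tdist_eq)
qed

lemma length_tpath_triangle:
  assumes "u \<in> V" "v \<in> V" "w \<in> V"
  shows "length (tpath T u w) \<le> length (tpath T u v) + length (tpath T v w)"
proof -
  have "card (sep u w) \<le> card (sep u v \<union> sep v w)"
    using finite_sep by (intro card_mono sep_triangle) auto
  also have "\<dots> \<le> card (sep u v) + card (sep v w)" by (rule card_Un_le)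
  finally show ?thesis using assms by (simp add: length_tpath)
qed

lemma sep_converse: "sep v u = prod.swap ` sep u v"
proof -
  have swap: "prod.swap e \<in> sep v u" if "e \<in> sep u v" for e u v
  proof -
    obtain a b where e: "e = (a,b)" by (cases e)
    have "(a,b) \<in> E" using that by (auto simp: e separating_def)
    then show ?thesis
      using that cut_systemD(3)[OF cuts, of a b] arcs_symmetric[of a b] by (auto simp: e separating_def)
  qed
  show ?thesis
  proof (intro equalityI subsetI)
    fix e assume "e \<in> sep v u"
    then show "e \<in> prod.swap ` sep u v" using swap[of e v u] by (intro image_eqI[of _ _ "prod.swap e"]) auto
  next
    fix e assume "e \<in> prod.swap ` sep u v"
    then show "e \<in> sep v u" using swap[of _ u v] by blast
  qed
qed

lemma tdist_commute:
  assumes "u \<in> V" "v \<in> V"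
  shows "tdist T v u = tdist T u v"
proof -
  have "sum (wgt T) (sep v u) = sum (wgt T \<circ> prod.swap) (sep u v)"
    unfolding sep_converse[of v u] by (rule sum.reindex) simp
  also have "\<dots> = sum (wgt T) (sep u v)"
    by (intro sum.cong) (auto simp: separating_def intro: wgt_sym)
  finally show ?thesis using assms by (simp add: tdist_eq)
qed

lemma length_tpath_commute:
  assumes "u \<in> V" "v \<in> V"
  shows "length (tpath T v u) = length (tpath T u v)"
proof -
  have "card (prod.swap ` sep u v) = card (sep u v)" by (intro card_image) simp
  then show ?thesis using assms by (simp add: length_tpath sep_converse[of v u])
qed

text \<open>The two halves of the subdivided edge inherit its cut, with \<open>s\<close> on the side
  of \<open>v\<close> for the half at \<open>u\<close>, and on the side of \<open>u\<close> for the
  half at \<open>v\<close>. In all other cuts \<open>s\<close> joins \<open>u\<close>. Cuts are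
  subsets of the whole type and may or may not contain the fresh \<open>s\<close>, so it is inserted
  or removed explicitly.\<close>

definition subdivided_cuts :: "'a \<Rightarrow> 'a \<Rightarrow> 'a \<Rightarrow> 'a \<times> 'a \<Rightarrow> 'a set" where
  "subdivided_cuts u v s e =
     (if e = (u,s) then insert s (c (u,v)) else if e = (s,u) then - insert s (c (u,v))
      else if e = (s,v) then c (u,v) - {s} else if e = (v,s) then - (c (u,v) - {s})
      else if u \<in> c e then insert s (c e) else c e - {s})"

text \<open>The surviving cuts separate old vertices as before, and the two new ones both do so like
  the cut of \<open>(u,v)\<close>. So on a path between old vertices an arc of the subdivided edge
  turns into two arcs of the same total weight.\<close>

lemma
  assumes uv: "(u,v) \<in> E" and s: "s \<notin> V" and \<delta>: "0 < \<delta>" "\<delta> < 1"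
  shows cut_tree_subdivide: "cut_tree (subdivide_edge T u v s \<delta>) (subdivided_cuts u v s)"
    (is "cut_tree ?T ?c")
  and tdist_subdivide: "\<And>x y. x \<in> V \<Longrightarrow> y \<in> V \<Longrightarrow> tdist (subdivide_edge T u v s \<delta>) x y = tdist T x y"
  and length_tpath_subdivide: "\<And>x y. x \<in> V \<Longrightarrow> y \<in> V \<Longrightarrow>
    length (tpath T x y) \<le> length (tpath (subdivide_edge T u v s \<delta>) x y)"
proof -
  have V: "pverts (tgraph ?T) = insert s V"
    and E: "parcs (tgraph ?T) = (E - {(u,v),(v,u)}) \<union> {(u,s),(s,u),(s,v),(v,s)}"
    and w: "wgt ?T = (wgt T)(
       (u,s) := \<delta> * wgt T (u,v), (s,u) := \<delta> * wgt T (u,v),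
       (s,v) := (1 - \<delta>) * wgt T (u,v), (v,s) := (1 - \<delta>) * wgt T (u,v))"
    by (auto simp: subdivide_edge_def)
  have uV: "u \<in> V" "v \<in> V" "u \<noteq> v" "u \<noteq> s" "v \<noteq> s" and vu: "(v,u) \<in> E"
    using in_arcsD1[OF uv] in_arcsD2[OF uv] s no_loops'[OF uv] arcs_symmetric[OF uv] by auto
  have sE: "(s,x) \<notin> E" "(x,s) \<notin> E" for x
    using s in_arcsD1[of s x] in_arcsD2[of x s] by auto
  have cD: "a \<notin> c (a,b)" "b \<in> c (a,b)" "c (b,a) = - c (a,b)" if "(a,b) \<in> E" for a b
    using cut_systemD[OF cuts that] by auto
  have cE: "x \<in> c (a,b) \<longleftrightarrow> y \<in> c (a,b)" if "(a,b) \<in> E" "(x,y) \<in> E" "(x,y) \<noteq> (a,b)" "(x,y) \<noteq> (b,a)" for a b x y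
    using cut_systemD(4)[OF cuts] that by blast
  have cut_old: "?c (a,b) = (if u \<in> c (a,b) then insert s (c (a,b)) else c (a,b) - {s})" if "(a,b) \<in> E" for a b
  proof -
    have "a \<noteq> s" "b \<noteq> s" using sE that by auto
    then show ?thesis by (simp add: subdivided_cuts_def)
  qed
  have cut_new: "?c (u,s) = insert s (c (u,v))" "?c (s,u) = - insert s (c (u,v))"
    "?c (s,v) = c (u,v) - {s}" "?c (v,s) = - (c (u,v) - {s})"
    using uV(3-5) by (simp_all add: subdivided_cuts_def)
  show cut_tree: "cut_tree ?T ?c"
  proof (rule cut_tree.intro)
    show "pair_graph (tgraph ?T)"
      using pair_graph_subdivide[OF uv s] by (simp add: subdivide_edge_def)
  next
    fix x y assume x: "x \<in> pverts (tgraph ?T)" and y: "y \<in> pverts (tgraph ?T)"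
    let ?R = "(parcs (tgraph ?T))\<^sup>*"
    have new: "(u,s) \<in> ?R" "(s,u) \<in> ?R" "(s,v) \<in> ?R" "(v,s) \<in> ?R" by (auto simp: E)
    have "(a,b) \<in> ?R" if "(a,b) \<in> E" for a b
    proof (cases "(a,b) = (u,v) \<or> (a,b) = (v,u)")
      case True
      then show ?thesis
        using rtrancl_trans[OF new(1,3)] rtrancl_trans[OF new(4,2)] by auto
    next
      case False
      then show ?thesis using that by (auto simp: E)
    qed
    then have "E\<^sup>* \<subseteq> ?R" by (intro rtrancl_subset_rtrancl) auto
    then have old: "(a,b) \<in> ?R" if "a \<in> V" "b \<in> V" for a b
      using connected that by blast
    have "(x,u) \<in> ?R" "(u,y) \<in> ?R"
      using x y old uV new unfolding V by auto
    then show "(x,y) \<in> ?R" by (rule rtrancl_trans)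
  next
    let ?K = "c (u,v)"
    have K: "u \<notin> ?K" "v \<in> ?K" using cD uv by auto
    have K_old: "x \<in> ?K \<longleftrightarrow> y \<in> ?K" "x \<noteq> s" "y \<noteq> s"
      if "(x,y) \<in> E" "(x,y) \<noteq> (u,v)" "(x,y) \<noteq> (v,u)" for x y
      using cE[OF uv] that sE by auto
    have side: "a \<notin> ?c (a,b) \<and> b \<in> ?c (a,b) \<and> ?c (b,a) = - ?c (a,b)"
      if "(a,b) \<in> parcs (tgraph ?T)" for a b
    proof (cases "(a,b) \<in> E")
      case True
      then have "a \<noteq> s" "b \<noteq> s" "(b,a) \<in> E" using sE arcs_symmetric[OF True] by auto
      then show ?thesis using cD[OF True] by (auto simp: cut_old True)
    next
      case False
      then show ?thesis using that K uV by (auto simp: E cut_new)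
    qed
    have noncut: "x \<in> ?c (a,b) \<longleftrightarrow> y \<in> ?c (a,b)"
      if ab: "(a,b) \<in> parcs (tgraph ?T)" and xy: "(x,y) \<in> parcs (tgraph ?T)"
        and ne: "(x,y) \<noteq> (a,b)" "(x,y) \<noteq> (b,a)" for a b x y
    proof (cases "(a,b) \<in> E")
      case True
      \<comment> \<open>The surviving edge \<open>(a,b)\<close> is not the subdivided one, so its
        cut keeps \<open>u\<close> and \<open>v\<close> together, and \<open>s\<close>, placed with
        \<open>u\<close>, is together with both.\<close>
      have uvab: "u \<in> c (a,b) \<longleftrightarrow> v \<in> c (a,b)"
        using cE[OF True uv] ab sE True unfolding E by auto
      show ?thesis
      proof (cases "(x,y) \<in> E")
        case xyE: True
        then have "x \<noteq> s" "y \<noteq> s" using sE by auto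
        then show ?thesis using cE[OF True xyE ne] by (simp add: cut_old True)
      next
        case False
        then show ?thesis using xy uvab uV by (auto simp: E cut_old True)
      qed
    next
      case False
      show ?thesis
      proof (cases "(x,y) \<in> E")
        case xyE: True
        then have "(x,y) \<noteq> (u,v)" "(x,y) \<noteq> (v,u)" using xy sE uV unfolding E by auto
        then show ?thesis using K_old[OF xyE] False ab by (auto simp: E cut_new)
      next
        case xyE: False
        then show ?thesis using False ab xy ne K uV by (auto simp: E cut_new)
      qed
    qed
    show "cut_system (parcs (tgraph ?T)) ?c"
      unfolding cut_system_def using side noncut by blast
  next
    fix a b assume "(a,b) \<in> parcs (tgraph ?T)"
    then consider "(a,b) \<in> E" | "(a,b) \<in> {(u,s),(s,u),(s,v),(v,s)}" by (auto simp: E)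
    then have "0 < wgt ?T (a,b) \<and> wgt ?T (b,a) = wgt ?T (a,b)"
    proof cases
      case 1
      then have "a \<noteq> s" "b \<noteq> s" using sE by auto
      then show ?thesis using wgt_pos[OF 1] wgt_sym[OF 1] by (simp add: w)
    next
      case 2
      then show ?thesis using \<delta> wgt_pos[OF uv] uV(3-5) by (auto simp: w)
    qed
    then show "0 < wgt ?T (a,b)" "wgt ?T (b,a) = wgt ?T (a,b)" by auto
  qed
  then interpret T': cut_tree ?T ?c .
  have sep': "T'.sep x y = (sep x y - {(u,v),(v,u)})
      \<union> (if (u,v) \<in> sep x y then {(u,s),(s,v)} else {})
      \<union> (if (v,u) \<in> sep x y then {(v,s),(s,u)} else {})" if "x \<in> V" "y \<in> V" for x y
  proof -
    have "x \<noteq> s" "y \<noteq> s" using that s by auto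
    have cvu: "z \<in> c (v,u) \<longleftrightarrow> z \<notin> c (u,v)" for z using cD(3)[OF uv] by simp
    have old: "e \<in> T'.sep x y \<longleftrightarrow> e \<in> sep x y" if "e \<in> E" "e \<noteq> (u,v)" "e \<noteq> (v,u)" for e
      using that \<open>x \<noteq> s\<close> \<open>y \<noteq> s\<close> by (cases e) (auto simp: separating_def E cut_old)
    have fwd: "e \<in> T'.sep x y \<longleftrightarrow> (u,v) \<in> sep x y" if "e = (u,s) \<or> e = (s,v)" for e
      using that \<open>x \<noteq> s\<close> \<open>y \<noteq> s\<close> uv uV(3-5) by (auto simp: separating_def E cut_new)
    have bwd: "e \<in> T'.sep x y \<longleftrightarrow> (v,u) \<in> sep x y" if "e = (v,s) \<or> e = (s,u)" for e
      using that \<open>x \<noteq> s\<close> \<open>y \<noteq> s\<close> vu uV(3-5) by (elim disjE) (simp_all add: separating_def E cut_new cvu)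
    have gone: "(u,v) \<notin> T'.sep x y" "(v,u) \<notin> T'.sep x y"
      using uV by (auto simp: separating_def E)
    have no_new: "(u,s) \<notin> sep x y" "(s,u) \<notin> sep x y" "(s,v) \<notin> sep x y" "(v,s) \<notin> sep x y"
      using sE by (simp_all add: separating_def)
    show ?thesis
    proof (rule set_eqI)
      fix e
      consider "e = (u,s) \<or> e = (s,v)" | "e = (v,s) \<or> e = (s,u)" | "e = (u,v) \<or> e = (v,u)"
        | "e \<noteq> (u,s)" "e \<noteq> (s,v)" "e \<noteq> (v,s)" "e \<noteq> (s,u)" "e \<noteq> (u,v)" "e \<noteq> (v,u)" by blast
      then show "e \<in> T'.sep x y \<longleftrightarrow> e \<in> (sep x y - {(u,v),(v,u)})
        \<union> (if (u,v) \<in> sep x y then {(u,s),(s,v)} else {})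
        \<union> (if (v,u) \<in> sep x y then {(v,s),(s,u)} else {})"
      proof cases
        case 1
        then show ?thesis using fwd[OF 1] no_new uV(3-5) by auto
      next
        case 2
        then show ?thesis using bwd[OF 2] no_new uV(3-5) by auto
      next
        case 3
        then show ?thesis using gone uV(3-5) by auto
      next
        case 4
        have "e \<in> T'.sep x y \<longleftrightarrow> e \<in> sep x y"
        proof (cases "e \<in> E")
          case True
          then show ?thesis using old 4 by blast
        next
          case False
          then show ?thesis using 4 by (simp add: separating_def E)
        qed
        then show ?thesis using 4 by simp
      qed
    qed
  qed
  have new: "(u,s) \<notin> sep x y" "(s,u) \<notin> sep x y" "(s,v) \<notin> sep x y" "(v,s) \<notin> sep x y" for x y
    using sE by (simp_all add: separating_def)
  have old: "sum (wgt ?T) (sep x y - {(u,v),(v,u)}) = sum (wgt T) (sep x y - {(u,v),(v,u)})" for x y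
  proof (rule sum.cong[OF refl])
    fix e assume "e \<in> sep x y - {(u,v),(v,u)}"
    then have "e \<noteq> (u,s)" "e \<noteq> (s,u)" "e \<noteq> (s,v)" "e \<noteq> (v,s)" using new by auto
    then show "wgt ?T e = wgt T e" by (simp add: w)
  qed
  have one: "\<not> ((u,v) \<in> sep x y \<and> (v,u) \<in> sep x y)" for x y
    by (simp add: separating_def cD(3)[OF uv])
  have wvu: "wgt T (v,u) = wgt T (u,v)" using wgt_sym[OF uv] .
  have wn: "wgt ?T (u,s) + wgt ?T (s,v) = wgt T (u,v)" "wgt ?T (v,s) + wgt ?T (s,u) = wgt T (v,u)"
    using uV(3-5) wvu by (simp_all add: w algebra_simps)
  have rem: "sum f (sep x y) = sum f (sep x y - {(u,v),(v,u)}) + f (u,v)"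
    if "(u,v) \<in> sep x y" for f :: "_ \<Rightarrow> real" and x y
  proof -
    have "sep x y - {(u,v),(v,u)} = sep x y - {(u,v)}" using one that by blast
    then show ?thesis using sum.remove[OF finite_sep that, of f] by simp
  qed
  have rem': "sum f (sep x y) = sum f (sep x y - {(u,v),(v,u)}) + f (v,u)"
    if "(v,u) \<in> sep x y" for f :: "_ \<Rightarrow> real" and x y
  proof -
    have "sep x y - {(u,v),(v,u)} = sep x y - {(v,u)}" using one that by blast
    then show ?thesis using sum.remove[OF finite_sep that, of f] by simp
  qed
  \<comment> \<open>Kept general in \<open>f\<close>: the weights give the distances, the constant
    \<open>1\<close> the numbers of edges.\<close>
  have total: "sum f (T'.sep x y) = sum f (sep x y - {(u,v),(v,u)})
      + (if (u,v) \<in> sep x y then f (u,s) + f (s,v) else 0)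
      + (if (v,u) \<in> sep x y then f (v,s) + f (s,u) else 0)"
    if "x \<in> V" "y \<in> V" for f :: "_ \<Rightarrow> real" and x y
    using one[of x y] finite_sep[of x y] new[of x y] uV by (auto simp: sep'[OF that])
  have V': "x \<in> T'.V" if "x \<in> V" for x using that by (simp add: V)
  have parts: "sum f (sep x y) = sum f (sep x y - {(u,v),(v,u)})
      + (if (u,v) \<in> sep x y then f (u,v) else 0) + (if (v,u) \<in> sep x y then f (v,u) else 0)"
    for f :: "_ \<Rightarrow> real" and x y
  proof -
    consider "(u,v) \<in> sep x y" "(v,u) \<notin> sep x y" | "(v,u) \<in> sep x y" "(u,v) \<notin> sep x y"
      | "(u,v) \<notin> sep x y" "(v,u) \<notin> sep x y" using one by blast
    then show ?thesis
    proof cases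
      case 1
      then show ?thesis unfolding rem[OF 1(1), of f] by simp
    next
      case 2
      then show ?thesis unfolding rem'[OF 2(1), of f] by simp
    next
      case 3
      then have "sep x y - {(u,v),(v,u)} = sep x y" by blast
      with 3 show ?thesis by simp
    qed
  qed
  show "tdist ?T x y = tdist T x y" if "x \<in> V" "y \<in> V" for x y
    unfolding tdist_eq[OF that] T'.tdist_eq[OF V'[OF that(1)] V'[OF that(2)]] total[OF that]
      parts[of "wgt T"] old wn ..
  show "length (tpath T x y) \<le> length (tpath ?T x y)" if "x \<in> V" "y \<in> V" for x y
  proof -
    have "real (card (sep x y)) \<le> real (card (T'.sep x y))"
      using total[OF that, of "\<lambda>_. 1"] parts[of "\<lambda>_. 1" x y] by simp
    then show ?thesis using that by (simp add: length_tpath T'.length_tpath V')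
  qed
qed

end

text \<open>Placing Steiner points preserves the old distances and can only raise the number of
  edges on a path. For a lower bound on complexity the latter is the harmless direction, so
  estimates made in \<open>T\<close> carry over to \<open>T'\<close>.\<close>

lemma steiner_placement_cut_tree:
  assumes "steiner_placement T A T'" "cut_tree T c"
  shows "\<exists>c'. cut_tree T' c' \<and> pverts (tgraph T) \<union> A \<subseteq> pverts (tgraph T') \<and>
    (\<forall>x\<in>pverts (tgraph T). \<forall>y\<in>pverts (tgraph T). tdist T' x y = tdist T x y \<and>
       length (tpath T x y) \<le> length (tpath T' x y))"
  using assms(1)
proof induction
  case none
  then show ?case using assms(2) by blast
next
  case (at_vertex A T' s)
  then show ?case by blast
next
  case (on_edge A T' u v s \<delta>)
  then obtain c' where c': "cut_tree T' c'" and sub: "pverts (tgraph T) \<union> A \<subseteq> pverts (tgraph T')"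
    and d: "\<forall>x\<in>pverts (tgraph T). \<forall>y\<in>pverts (tgraph T). tdist T' x y = tdist T x y \<and>
       length (tpath T x y) \<le> length (tpath T' x y)" by blast
  interpret T': cut_tree T' c' by fact
  note hyps = on_edge.hyps(2-5)
  let ?S = "subdivide_edge T' u v s \<delta>"
  have V: "pverts (tgraph ?S) = insert s (pverts (tgraph T'))"
    by (simp add: subdivide_edge_def)
  have "tdist ?S x y = tdist T x y \<and> length (tpath T x y) \<le> length (tpath ?S x y)"
    if xy: "x \<in> pverts (tgraph T)" "y \<in> pverts (tgraph T)" for x y
  proof -
    have T': "x \<in> pverts (tgraph T')" "y \<in> pverts (tgraph T')" using that sub by auto
    have "tdist T' x y = tdist T x y" "length (tpath T x y) \<le> length (tpath T' x y)"
      using d xy by auto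
    then show ?thesis
      using T'.tdist_subdivide[OF hyps T'] T'.length_tpath_subdivide[OF hyps T'] by simp
  qed
  moreover have "pverts (tgraph T) \<union> insert s A \<subseteq> pverts (tgraph ?S)"
    unfolding V using sub by auto
  ultimately show ?case using T'.cut_tree_subdivide[OF hyps] by blast
qed

section \<open>Caterpillars\<close>

text \<open>
  The spine is the path \<open>0, \<dots>, P - 1\<close>, rooted at \<open>P - 1\<close> so that its far end is no leaf;
  leaf \<open>P + j\<close> hangs at the spine vertex \<open>j * M\<close>.
\<close>

locale caterpillar =
  fixes P n M :: nat and W :: "nat \<Rightarrow> real"
  assumes foot_less: "j < n \<Longrightarrow> j * M < P"
    and leaf_exists: "0 < n"
    and W_pos: "0 < W s"
begin

text \<open>Each edge occurs once, directed towards the larger vertex number. This is not the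
  direction towards the root: legs lead to the leaves, spine arcs to the root.\<close>

definition up :: "(nat \<times> nat) set" where
  "up = {(s, Suc s) | s. Suc s < P} \<union> {(j * M, P + j) | j. j < n}"

definition T :: "nat rtree" where
  "T = \<lparr>tgraph = \<lparr>pverts = {..<P + n}, parcs = up \<union> up\<inverse>\<rparr>, troot = P - 1,
        wgt = (\<lambda>(a,b). if P \<le> a \<or> P \<le> b then 1 else W (min a b))\<rparr>"

definition foot :: "nat \<Rightarrow> nat" where
  "foot v = (if v < P then v else (v - P) * M)"

text \<open>Removing a leg isolates its leaf; removing a spine edge splits the vertices by the
  position of their feet.\<close>

definition cut :: "nat \<times> nat \<Rightarrow> nat set" where
  "cut = (\<lambda>(a,b). if P \<le> b then {b} else if P \<le> a then - {a}
     else if a < b then {v. a < foot v} else {v. foot v \<le> b})"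

lemma verts_T: "pverts (tgraph T) = {..<P + n}"
  and arcs_T: "parcs (tgraph T) = up \<union> up\<inverse>"
  and root_T: "troot T = P - 1"
  and wgt_T: "wgt T (a,b) = (if P \<le> a \<or> P \<le> b then 1 else W (min a b))"
  by (simp_all add: T_def)

lemma P_pos: "0 < P"
  using foot_less[OF leaf_exists] by simp

lemma upE:
  assumes "(a,b) \<in> up"
  obtains (spine) s where "a = s" "b = Suc s" "Suc s < P"
    | (leg) j where "a = j * M" "b = P + j" "j < n" "j * M < P"
  using assms foot_less by (auto simp: up_def)

lemma up_less: "(a,b) \<in> up \<Longrightarrow> a < b \<and> a < P \<and> b < P + n"
  by (elim upE) auto

lemma cut_up:
  assumes "(a,b) \<in> up"
  shows "cut (a,b) = (if P \<le> b then {b} else {v. a < foot v})" and "cut (b,a) = - cut (a,b)"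
proof -
  show "cut (a,b) = (if P \<le> b then {b} else {v. a < foot v})"
    using up_less[OF assms] by (simp add: cut_def)
  show "cut (b,a) = - cut (a,b)"
    using up_less[OF assms] by (auto simp: cut_def)
qed

lemma cut_up_mem:
  assumes "(a,b) \<in> up"
  shows "a \<notin> cut (a,b)" "b \<in> cut (a,b)"
  using assms by (auto elim!: upE simp: cut_up[OF assms] foot_def)

lemma cut_up_other:
  assumes ab: "(a,b) \<in> up" and xy: "(x,y) \<in> up" "(x,y) \<noteq> (a,b)"
  shows "x \<in> cut (a,b) \<longleftrightarrow> y \<in> cut (a,b)"
  using xy(1)
proof (cases rule: upE)
  case (spine s)
  then show ?thesis using ab xy(2) by (auto elim!: upE simp: cut_up[OF ab] foot_def)
next
  case (leg j)
  then show ?thesis using ab xy(2) by (auto elim!: upE simp: cut_up[OF ab] foot_def)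
qed

lemma cut_system_T: "cut_system (up \<union> up\<inverse>) cut"
proof -
  have up: "a \<notin> cut (a,b) \<and> b \<in> cut (a,b) \<and> cut (b,a) = - cut (a,b) \<and>
     (\<forall>x y. (x,y) \<in> up \<union> up\<inverse> \<longrightarrow> (x,y) \<noteq> (a,b) \<longrightarrow> (x,y) \<noteq> (b,a) \<longrightarrow> (x \<in> cut (a,b) \<longleftrightarrow> y \<in> cut (a,b)))"
    if "(a,b) \<in> up" for a b
    using cut_up_mem[OF that] cut_up(2)[OF that] cut_up_other[OF that] by blast
  show ?thesis
    unfolding cut_system_def
  proof (intro allI impI)
    fix a b assume "(a,b) \<in> up \<union> up\<inverse>"
    then consider "(a,b) \<in> up" | "(b,a) \<in> up" by blast
    then show "a \<notin> cut (a,b) \<and> b \<in> cut (a,b) \<and> cut (b,a) = - cut (a,b) \<and>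
     (\<forall>x y. (x,y) \<in> up \<union> up\<inverse> \<longrightarrow> (x,y) \<noteq> (a,b) \<longrightarrow> (x,y) \<noteq> (b,a) \<longrightarrow> (x \<in> cut (a,b) \<longleftrightarrow> y \<in> cut (a,b)))"
    proof cases
      case 1
      then show ?thesis by (rule up)
    next
      case 2
      have "cut (a,b) = - cut (b,a)" using up[OF 2] by blast
      then show ?thesis using up[OF 2] by (metis Compl_iff double_compl)
    qed
  qed
qed

lemma connected_T:
  assumes "u < P + n" "v < P + n"
  shows "(u,v) \<in> (up \<union> up\<inverse>)\<^sup>*"
proof -
  let ?R = "(up \<union> up\<inverse>)\<^sup>*"
  have spine: "(0,s) \<in> ?R" if "s < P" for s
    using that
  proof (induction s)
    case (Suc s)
    then have "(0,s) \<in> ?R" "(s, Suc s) \<in> up \<union> up\<inverse>" by (auto simp: up_def)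
    then show ?case by (rule rtrancl_into_rtrancl)
  qed simp
  have from0: "(0,w) \<in> ?R" if "w < P + n" for w
  proof (cases "w < P")
    case False
    then have "w - P < n" using that by simp
    then have "(0, (w - P) * M) \<in> ?R" "((w - P) * M, P + (w - P)) \<in> up \<union> up\<inverse>"
      using spine foot_less by (auto simp: up_def)
    then have "(0, P + (w - P)) \<in> ?R" by (rule rtrancl_into_rtrancl)
    then show ?thesis using False by simp
  qed (rule spine)
  have "sym ?R" by (intro sym_rtrancl) (auto simp: sym_def)
  then have "(u,0) \<in> ?R" using from0[OF assms(1)] by (rule symD)
  then show ?thesis using from0[OF assms(2)] by (rule rtrancl_trans)
qed

sublocale cut_tree T cut
proof (rule cut_tree.intro)
  have verts: "a < P + n \<and> b < P + n \<and> a \<noteq> b" if "(a,b) \<in> up \<union> up\<inverse>" for a b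
    using that up_less[of a b] up_less[of b a] by auto
  have "up \<union> up\<inverse> \<subseteq> {..<P + n} \<times> {..<P + n}" using verts by auto
  then have "finite (up \<union> up\<inverse>)" by (rule finite_subset) simp
  moreover have "sym (up \<union> up\<inverse>)" by (auto simp: sym_def)
  ultimately show "pair_graph (tgraph T)"
    by unfold_locales (auto simp: verts_T arcs_T symmetric_def dest: up_less)
  show "(u,v) \<in> (parcs (tgraph T))\<^sup>*" if "u \<in> pverts (tgraph T)" "v \<in> pverts (tgraph T)" for u v
    using connected_T that by (simp add: verts_T arcs_T)
  show "cut_system (parcs (tgraph T)) cut"
    unfolding arcs_T by (rule cut_system_T)
  show "0 < wgt T (u,v)" "wgt T (v,u) = wgt T (u,v)" for u v
    using W_pos by (auto simp: wgt_T min.commute)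
qed

lemma weighted_rooted_tree_T: "weighted_rooted_tree T"
  using undirected_tree P_pos wgt_pos wgt_sym
  unfolding weighted_rooted_tree_def by (auto simp: verts_T root_T)

section \<open>Paths between leaves\<close>

lemma sep_legs:
  assumes "i < j" "j < n"
  shows "sep (P + i) (P + j) =
    insert (P + i, i * M) (insert (j * M, P + j) ((\<lambda>s. (s, Suc s)) ` {i * M..<j * M}))"
    (is "?L = ?R")
proof (intro equalityI subsetI)
  fix e assume "e \<in> ?L"
  then obtain a b where e: "e = (a,b)" "(a,b) \<in> up \<union> up\<inverse>" "P + i \<notin> cut (a,b)" "P + j \<in> cut (a,b)"
    by (cases e) (auto simp: separating_def arcs_T)
  have ij: "s < j * M" if "s < i * M" for s
    using that assms by (meson less_le_trans less_imp_le mult_le_mono1)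
  from e(2) consider "(a,b) \<in> up" | "(b,a) \<in> up" by blast
  then show "e \<in> ?R"
  proof cases
    case 1
    then show ?thesis using e(3,4) cut_up(1)[OF 1] unfolding e(1)
      by (cases rule: upE) (auto simp: foot_def)
  next
    case 2
    then show ?thesis using e(3,4) cut_up[OF 2] ij unfolding e(1)
      by (cases rule: upE) (auto simp: foot_def)
  qed
next
  fix e assume "e \<in> ?R"
  then consider "e = (P + i, i * M)" | "e = (j * M, P + j)"
    | s where "e = (s, Suc s)" "i * M \<le> s" "s < j * M" by auto
  then show "e \<in> ?L"
  proof cases
    case 1
    have up: "(i * M, P + i) \<in> up" using assms by (auto simp: up_def)
    then show ?thesis using cut_up[OF up] assms by (auto simp: 1 separating_def arcs_T)
  next
    case 2
    have up: "(j * M, P + j) \<in> up" using assms by (auto simp: up_def)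
    then show ?thesis using cut_up[OF up] assms by (auto simp: 2 separating_def arcs_T)
  next
    case 3
    have "Suc s < P" using 3 foot_less[OF assms(2)] by simp
    then have up: "(s, Suc s) \<in> up" by (auto simp: up_def)
    then show ?thesis using cut_up(1)[OF up] \<open>Suc s < P\<close> 3
      by (auto simp: separating_def arcs_T foot_def)
  qed
qed

lemma leg_in_verts: "j < n \<Longrightarrow> P + j \<in> V"
  by (simp add: verts_T)

lemma
  assumes "i < j" "j < n"
  shows tdist_legs: "tdist T (P + i) (P + j) = 2 + sum W {i * M..<j * M}"
    and length_tpath_legs: "length (tpath T (P + i) (P + j)) = 2 + (j - i) * M"
proof -
  let ?S = "(\<lambda>s. (s, Suc s)) ` {i * M..<j * M}"
  have P: "s < P" "Suc s < P" if "s < j * M" for s using that foot_less[OF assms(2)] by auto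
  have iM: "i * M < P" using foot_less assms by simp
  have new: "(j * M, P + j) \<notin> ?S" "(P + i, i * M) \<notin> insert (j * M, P + j) ?S"
    using P iM assms by auto
  have inj: "inj_on (\<lambda>s. (s, Suc s)) A" for A by (rule inj_onI) simp
  have V: "P + i \<in> V" "P + j \<in> V" using assms leg_in_verts by auto
  have "sum (wgt T) ?S = sum W {i * M..<j * M}"
    by (subst sum.reindex[OF inj]) (auto simp: wgt_T dest!: P intro!: sum.cong)
  then show "tdist T (P + i) (P + j) = 2 + sum W {i * M..<j * M}"
    unfolding tdist_eq[OF V] sep_legs[OF assms] using new by (simp add: wgt_T)
  have "card ?S = (j - i) * M" using inj by (simp add: card_image diff_mult_distrib)
  then show "length (tpath T (P + i) (P + j)) = 2 + (j - i) * M"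
    unfolding length_tpath[OF V] sep_legs[OF assms] using new by simp
qed

lemma children_T: "u \<in> V \<Longrightarrow> children T u = {v. (u,v) \<in> sep (troot T) v}"
proof -
  have "troot T \<in> V" using P_pos by (simp add: verts_T root_T)
  then have "children T u = {v \<in> V. (u,v) \<in> sep (troot T) v}"
    by (auto simp: children_def tpath(1))
  also have "\<dots> = {v. (u,v) \<in> sep (troot T) v}"
    using in_arcsD2 by (auto simp: separating_def)
  finally show ?thesis .
qed

text \<open>With the root at the last spine vertex, spine vertex \<open>0\<close> has the child
  \<open>P\<close>, and every other spine vertex has its predecessor as a child. The only neighbour
  of a leg's end is on the side of the root.\<close>

lemma leaves_T: "leaves T = {P..<P + n}"
proof (intro equalityI subsetI)
  fix u assume u: "u \<in> leaves T"
  then have uV: "u < P + n" "children T u = {}" by (auto simp: leaves_def verts_T)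
  show "u \<in> {P..<P + n}"
  proof (rule ccontr)
    assume "u \<notin> {P..<P + n}"
    then have uP: "u < P" using uV by auto
    have "\<exists>v. v \<in> children T u"
    proof (cases u)
      case 0
      have up: "(0, P) \<in> up" using leaf_exists by (force simp: up_def)
      have "P \<in> children T u"
        using uV cut_up(1)[OF up] up P_pos
        by (auto simp: children_T verts_T separating_def arcs_T 0 root_T)
      then show ?thesis by blast
    next
      case (Suc s)
      have up: "(s, u) \<in> up" using uP by (auto simp: up_def Suc)
      have "s \<in> children T u"
        using uV cut_up[OF up] up uP
        by (auto simp: children_T verts_T separating_def arcs_T Suc root_T foot_def)
      then show ?thesis by blast
    qed
    with uV show False by simp
  qed
next
  fix u assume "u \<in> {P..<P + n}"
  then obtain j where j: "u = P + j" "j < n" by (auto dest: le_Suc_ex)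
  have "v \<notin> children T u" for v
  proof
    assume "v \<in> children T u"
    then have v: "(u,v) \<in> up \<union> up\<inverse>" "P - 1 \<notin> cut (u,v)"
      using j by (auto simp: children_T verts_T separating_def arcs_T root_T)
    then have up: "(v,u) \<in> up" using j up_less[of u v] by auto
    then show False using v(2) cut_up[OF up] j P_pos by auto
  qed
  then show "u \<in> leaves T" using j by (auto simp: leaves_def verts_T)
qed

end

section \<open>Clustered caterpillars\<close>

text \<open>Finite distance yields a simple path of links from \<open>p\<close> to \<open>q\<close>.
  By the triangle inequality their complexities add up to at least that of \<open>(p,q)\<close>, and
  since no arc repeats, the sum over all arcs of \<open>G\<close> bounds them; this sum is twice the
  complexity.\<close>

lemma length_tpath_le_complexity:
  assumes "cut_tree T c" "pair_graph G" "pverts G \<subseteq> pverts (tgraph T)"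
    and "wf_digraph.\<mu> (with_proj G) w p q < \<infinity>"
  shows "real (length (tpath T p q)) \<le> 2 * complexity T G"
proof -
  interpret T: cut_tree T c by fact
  interpret G: pair_graph G by fact
  obtain \<pi>' where "G.awalk p \<pi>' q"
    using assms(4) G.shortest_path_inf[of p q w] G.reachable_awalk[of p q] by auto
  then obtain \<pi> where \<pi>: "G.apath p \<pi> q" using G.apath_awalk_to_apath by blast
  have "length (tpath T p q) \<le> (\<Sum>(a,b)\<leftarrow>\<pi>. length (tpath T a b))" if "G.awalk p \<pi> q" for \<pi>
    using that
  proof (induction \<pi> arbitrary: p)
    case Nil
    then have "p = q" "q \<in> T.V" using assms(3) by (auto simp: G.awalk_Nil_iff)
    then show ?case by (simp add: T.length_tpath separating_def)
  next
    case (Cons e \<pi>)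
    then obtain x where e: "e = (p,x)" "(p,x) \<in> parcs G" "G.awalk x \<pi> q"
      by (cases e) (auto simp: G.awalk_Cons_iff)
    have "p \<in> pverts G" "x \<in> pverts G" "q \<in> pverts G"
      using e(2) G.in_arcsD1 G.in_arcsD2 G.awalk_last_in_verts[OF e(3)] by auto
    then have "p \<in> T.V" "x \<in> T.V" "q \<in> T.V" using assms(3) by auto
    then show ?case using T.length_tpath_triangle[of p x q] Cons.IH[OF e(3)] by (simp add: e(1))
  qed
  also have "(\<Sum>(a,b)\<leftarrow>\<pi>. length (tpath T a b)) = (\<Sum>(a,b)\<in>set \<pi>. length (tpath T a b))"
    using \<pi> G.distinct_verts_imp_distinct[of p \<pi> q] unfolding G.apath_def
    by (intro sum_list_distinct_conv_sum_set) blast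
  also have "\<dots> \<le> (\<Sum>(a,b)\<in>parcs G. length (tpath T a b))"
    using \<pi> G.pair_finite_arcs by (intro sum_mono2) (auto simp: G.apath_def G.awalk_def)
  finally have "length (tpath T p q) \<le> (\<Sum>(a,b)\<in>parcs G. length (tpath T a b))"
    using \<pi> by (simp add: G.apath_def)
  then show ?thesis unfolding complexity_def by linarith
qed

text \<open>The link on which a walk first leaves \<open>L\<close> would alone use up the budget
  \<open>B\<close>. So the walk stays in \<open>L\<close>, where every hop costs at least
  \<open>2\<close>. With \<open>B = 2 * t\<close> this means fewer than \<open>t\<close>
  hops.\<close>

lemma (in pair_graph) cheap_walk_hops:
  fixes d :: "'a \<times> 'a \<Rightarrow> real" and B :: real
  assumes nonneg: "\<And>e. e \<in> parcs G \<Longrightarrow> 0 \<le> d e"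
    and leave: "\<And>x y. x \<in> L \<Longrightarrow> y \<in> pverts G \<Longrightarrow> y \<notin> L \<Longrightarrow> B \<le> d (x,y)"
    and inside: "\<And>x y. x \<in> L \<Longrightarrow> y \<in> L \<Longrightarrow> x \<noteq> y \<Longrightarrow> 2 \<le> d (x,y)"
    and "awalk x p y" "x \<in> L" "awalk_cost d p < B"
  shows "(x,y) \<in> (parcs G \<inter> L \<times> L) ^^ length p \<and> 2 * real (length p) \<le> awalk_cost d p"
  using assms(4-)
proof (induction p arbitrary: x)
  case Nil
  then show ?case by (auto simp: awalk_Nil_iff)
next
  case (Cons e p)
  then obtain z where e: "e = (x,z)" "(x,z) \<in> parcs G" "awalk z p y"
    by (cases e) (auto simp: awalk_Cons_iff)
  have z: "z \<in> pverts G" "z \<noteq> x" using e(2) in_arcsD2 no_loops' by auto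
  have cost: "0 \<le> awalk_cost d p" using pos_cost_pos_awalk_cost[OF e(3)] nonneg by simp
  have "z \<in> L"
  proof (rule ccontr)
    assume "z \<notin> L"
    then have "B \<le> d (x,z)" using leave Cons.prems z by blast
    then show False using cost Cons.prems(3) by (simp add: e(1))
  qed
  moreover have "2 \<le> d (x,z)" using inside \<open>z \<in> L\<close> Cons.prems(2) z(2) by metis
  moreover have "(z,y) \<in> (parcs G \<inter> L \<times> L) ^^ length p \<and> 2 * real (length p) \<le> awalk_cost d p"
    using Cons.IH[OF e(3) \<open>z \<in> L\<close>] Cons.prems(3) nonneg[OF e(2)] by (simp add: e(1))
  moreover have "(x,z) \<in> parcs G \<inter> L \<times> L" using e(2) Cons.prems(2) \<open>z \<in> L\<close> by simp
  ultimately show ?case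
    using relpow_Suc_I2[of x z "parcs G \<inter> L \<times> L" y "length p"] by (simp add: e(1))
qed

text \<open>
  Consecutive groups of \<open>N\<close> leaves are kept apart by spine edges of weight \<open>4 * t\<close>, so that a
  Steiner point is closer than \<open>2 * t\<close> to the leaves of at most one group.
\<close>

locale clustered_caterpillar =
  fixes P n M N t :: nat and \<eta> :: real
  assumes foot_less': "j < n \<Longrightarrow> j * M < P"
    and pos: "0 < n" "0 < M" "0 < N" "0 < t" "0 < \<eta>"
begin

text \<open>Spine edge \<open>s\<close> joins \<open>s\<close> and \<open>Suc s\<close>. It is heavy
  if \<open>Suc s\<close> is a multiple of \<open>N * M\<close>, the position for the foot of a
  group's first leaf.\<close>

definition W :: "nat \<Rightarrow> real" where
  "W s = (if N * M dvd Suc s then 4 * real t else \<eta>)"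

sublocale caterpillar P n M W
  using foot_less' pos by unfold_locales (auto simp: W_def)

definition group :: "nat \<Rightarrow> nat set" where
  "group g = {g * N..<Suc g * N}"

section \<open>Distances within and between groups\<close>

lemma W_nonneg: "0 \<le> W s"
  using W_pos less_imp_le by blast

lemma tdist_legs_commute:
  "i < n \<Longrightarrow> j < n \<Longrightarrow> tdist T (P + j) (P + i) = tdist T (P + i) (P + j)"
  using tdist_commute leg_in_verts by blast

lemma tdist_legs_ge:
  assumes "i < n" "j < n" "i \<noteq> j"
  shows "2 \<le> tdist T (P + i) (P + j)"
proof -
  have "2 \<le> tdist T (P + i) (P + j)" if "i < j" "j < n" for i j
    using that by (simp add: tdist_legs sum_nonneg W_nonneg)
  from this[of i j] this[of j i] show ?thesis
    using assms tdist_legs_commute by (cases "i < j") auto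
qed

lemma length_tpath_legs_ge:
  assumes "i < n" "j < n"
  shows "real M * \<bar>real i - real j\<bar> \<le> real (length (tpath T (P + i) (P + j)))"
proof -
  have le: "real M * \<bar>real i - real j\<bar> \<le> real (length (tpath T (P + i) (P + j)))"
    if "i < j" "j < n" for i j
    using that by (simp add: length_tpath_legs of_nat_diff algebra_simps)
  have "length (tpath T (P + j) (P + i)) = length (tpath T (P + i) (P + j))"
    using length_tpath_commute assms leg_in_verts by blast
  then show ?thesis
    using le[of i j] le[of j i] assms by (cases i j rule: linorder_cases) (auto simp: abs_minus_commute)
qed

text \<open>A heavy edge between the feet would give a multiple of \<open>N\<close> in
  \<open>{i<..j}\<close>, but the only multiple of \<open>N\<close> in a group is its first index.
  What remains are two legs and fewer than \<open>P\<close> light edges.\<close>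

lemma tdist_same_group:
  assumes "i \<in> group g" "j \<in> group g" "i < n" "j < n"
  shows "tdist T (P + i) (P + j) \<le> 2 + real P * \<eta>"
proof -
  have less: "tdist T (P + i) (P + j) \<le> 2 + real P * \<eta>"
    if "i < j" "i \<in> group g" "j \<in> group g" "j < n" for i j
  proof -
    have "W s = \<eta>" if s: "i * M \<le> s" "s < j * M" for s
    proof -
      have False if "N * M dvd Suc s"
      proof -
        from that obtain q where q: "Suc s = (q * N) * M" by (auto simp: dvd_def mult_ac)
        have "i * M < (q * N) * M" "(q * N) * M \<le> j * M" using s q by linarith+
        then have "i < q * N" "q * N \<le> j" using pos(2) by auto
        moreover have "g * N \<le> i" "j < Suc g * N"
          using \<open>i \<in> group g\<close> \<open>j \<in> group g\<close> by (simp_all add: group_def)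
        ultimately have "g * N < q * N" "q * N < Suc g * N" by linarith+
        then have "g < q" "q < Suc g" using mult_less_cancel2 by blast+
        then show False by simp
      qed
      then show ?thesis by (auto simp: W_def)
    qed
    then have "sum W {i * M..<j * M} = (\<Sum>s\<in>{i * M..<j * M}. \<eta>)" by (intro sum.cong) auto
    also have "\<dots> = real (j * M - i * M) * \<eta>" by simp
    also have "\<dots> \<le> real P * \<eta>" using foot_less[OF \<open>j < n\<close>] pos by (intro mult_right_mono) auto
    finally show ?thesis using that by (simp add: tdist_legs)
  qed
  have "tdist T (P + i) (P + i) \<le> 2 + real P * \<eta>"
    using pos assms leg_in_verts by (simp add: tdist_eq separating_def)
  then show ?thesis
    using less[of i j] less[of j i] assms tdist_legs_commute[of i j]
    by (cases i j rule: linorder_cases) auto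
qed

lemma tdist_other_group:
  assumes "i \<in> group g" "j \<notin> group g" "i < n" "j < n"
  shows "4 * real t \<le> tdist T (P + i) (P + j)"
proof -
  have less: "4 * real t \<le> tdist T (P + i) (P + j)"
    if "i < q * N" "q * N \<le> j" "j < n" for i j q
  proof -
    \<comment> \<open>The last spine edge before the foot of leaf \<open>q * N\<close>; it is heavy
      and lies between the two feet.\<close>
    define s where "s = q * N * M - 1"
    have "Suc i * M \<le> q * N * M" using that by (intro mult_le_mono1) simp
    then have "i * M + M \<le> q * N * M" by simp
    moreover have "q * N * M \<le> j * M" using that by (intro mult_le_mono1) simp
    ultimately have "i * M \<le> s" "s < j * M" and s': "Suc s = q * N * M"
      using pos(2) unfolding s_def by linarith+
    then have s: "s \<in> {i * M..<j * M}" "Suc s = q * N * M" by auto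
    have "4 * real t = W s" by (simp add: W_def s(2))
    also have "\<dots> \<le> sum W {i * M..<j * M}"
      using s(1) W_nonneg by (intro member_le_sum) auto
    finally show ?thesis using that by (simp add: tdist_legs)
  qed
  show ?thesis
  proof (cases "j < g * N")
    case True
    then show ?thesis
      using less[of j g i] assms tdist_legs_commute[of i j] by (auto simp: group_def)
  next
    case False
    then show ?thesis using less[of i "Suc g" j] assms by (auto simp: group_def)
  qed
qed

lemma group_disjoint: "i \<in> group g \<Longrightarrow> i \<in> group h \<Longrightarrow> g = h"
proof -
  assume "i \<in> group g" "i \<in> group h"
  then have "g * N \<le> i" "i < Suc h * N" "h * N \<le> i" "i < Suc g * N"
    by (simp_all add: group_def)
  then have "g * N < Suc h * N" "h * N < Suc g * N" by linarith+
  then have "g < Suc h" "h < Suc g" using mult_less_cancel2 by blast+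
  then show "g = h" by simp
qed

section \<open>Groups without a nearby Steiner point\<close>

definition group_links :: "nat pair_pre_digraph \<Rightarrow> nat \<Rightarrow> (nat \<times> nat) set" where
  "group_links G g = {(i,j). i \<in> group g \<and> j \<in> group g \<and> (P + i, P + j) \<in> parcs G}"

lemma finite_group_links: "finite (group_links G g)"
  by (rule finite_subset[of _ "group g \<times> group g"]) (auto simp: group_links_def group_def)

lemma group_less:
  assumes "g < h" "h * N \<le> n" "i \<in> group g"
  shows "i < n"
proof -
  have "Suc g * N \<le> h * N" using assms by (intro mult_le_mono1) simp
  then show ?thesis using assms by (simp add: group_def)
qed

text \<open>A Steiner point near two groups would bring them closer than \<open>4 * t\<close>, so
  each one spoils at most one group. For two leaves of an unspoiled group the spanner has a walk
  cheaper than \<open>2 * t\<close>, while leaving the group costs at least \<open>2 * t\<close>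
  towards a Steiner point and \<open>4 * t\<close> towards another leaf. So
  \<open>cheap_walk_hops\<close> applies.\<close>

lemma clean_groups:
  assumes spanner: "steiner_spanner \<tau> T A T' G" and A: "finite A"
    and \<tau>: "0 \<le> \<tau>" "\<tau> * (2 + real P * \<eta>) < 2 * real t"
    and h: "h * N \<le> n"
  shows "\<exists>H\<subseteq>{..<h}. h \<le> card H + card A \<and>
    (\<forall>g\<in>H. \<forall>i\<in>group g. \<forall>j\<in>group g. \<exists>l<t. (i,j) \<in> group_links G g ^^ l)"
proof -
  have G: "pair_graph G" "pverts G = leaves T \<union> A" and place: "steiner_placement T A T'"
    and \<mu>: "\<And>p q. p \<in> leaves T \<Longrightarrow> q \<in> leaves T \<Longrightarrow>
      wf_digraph.\<mu> (with_proj G) (\<lambda>(x,y). tdist T' x y) p q \<le> ereal (\<tau> * tdist T' p q)"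
    using spanner by (auto simp: steiner_spanner_def)
  obtain c' where T': "cut_tree T' c'" and V': "V \<union> A \<subseteq> pverts (tgraph T')"
    and dist: "\<And>x y. x \<in> V \<Longrightarrow> y \<in> V \<Longrightarrow> tdist T' x y = tdist T x y"
    using steiner_placement_cut_tree[OF place cut_tree_axioms] by blast
  interpret G: pair_graph G by fact
  interpret T': cut_tree T' c' by fact
  have GV: "pverts G \<subseteq> T'.V" using V' by (auto simp: G(2) leaves_def)
  have dist_legs: "tdist T' (P + i) (P + j) = tdist T (P + i) (P + j)" if "i < n" "j < n" for i j
    using dist leg_in_verts that by blast
  have less_n: "i < n" if "i \<in> group g" "g < h" for i g using group_less[OF that(2) h that(1)] .
  \<comment> \<open>Measured in \<open>T'\<close>, because a Steiner point inside an edge is not a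
    vertex of \<open>T\<close>.\<close>
  define near where "near = (\<lambda>s g. \<exists>i\<in>group g. tdist T' (P + i) s < 2 * real t)"
  have near_unique: "g = g'" if s: "s \<in> A" and g: "g < h" "near s g" "g' < h" "near s g'" for s g g'
  proof (rule ccontr)
    assume "g \<noteq> g'"
    from g obtain i i' where i: "i \<in> group g" "tdist T' (P + i) s < 2 * real t"
      and i': "i' \<in> group g'" "tdist T' (P + i') s < 2 * real t" by (auto simp: near_def)
    have n: "i < n" "i' < n" using less_n i i' g by auto
    have V: "P + i \<in> T'.V" "P + i' \<in> T'.V" "s \<in> T'.V" using n leg_in_verts V' s by auto
    have "4 * real t \<le> tdist T (P + i) (P + i')"
      using tdist_other_group[OF i(1)] i'(1) group_disjoint \<open>g \<noteq> g'\<close> n by blast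
    also have "\<dots> = tdist T' (P + i) (P + i')" using dist_legs n by simp
    also have "\<dots> \<le> tdist T' (P + i) s + tdist T' s (P + i')"
      using T'.tdist_triangle V by blast
    also have "tdist T' s (P + i') = tdist T' (P + i') s" using T'.tdist_commute V by blast
    finally show False using i(2) i'(2) by linarith
  qed
  define H where "H = {g. g < h \<and> \<not> (\<exists>s\<in>A. near s g)}"
  define D where "D = {g. g < h \<and> (\<exists>s\<in>A. near s g)}"
  \<comment> \<open>Charge each spoiled group to a Steiner point near it; by
    \<open>near_unique\<close> the point determines the group.\<close>
  have "D \<subseteq> (\<lambda>s. THE g. g < h \<and> near s g) ` A"
  proof
    fix g assume "g \<in> D"
    then obtain s where s: "g < h" "s \<in> A" "near s g" by (auto simp: D_def)
    then have "(THE g. g < h \<and> near s g) = g" using near_unique by (intro the_equality) blast+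
    then show "g \<in> (\<lambda>s. THE g. g < h \<and> near s g) ` A" using s by (intro image_eqI[of _ _ s]) auto
  qed
  then have "card D \<le> card A" using A surj_card_le by blast
  moreover have "card H + card D = h"
  proof -
    have "card (H \<union> D) = card H + card D"
      by (intro card_Un_disjoint) (auto simp: H_def D_def)
    moreover have "H \<union> D = {..<h}" by (auto simp: H_def D_def)
    ultimately show ?thesis by simp
  qed
  ultimately have "h \<le> card H + card A" by simp
  moreover have "\<exists>l<t. (i,j) \<in> group_links G g ^^ l"
    if g: "g \<in> H" and i: "i \<in> group g" and j: "j \<in> group g" for g i j
  proof -
    have gh: "g < h" and clean: "\<And>s i. s \<in> A \<Longrightarrow> i \<in> group g \<Longrightarrow> 2 * real t \<le> tdist T' (P + i) s"
      using g by (auto simp: H_def near_def not_less)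
    let ?L = "(+) P ` group g"
    have n: "i < n" "j < n" using less_n gh i j by auto
    have "\<tau> * tdist T' (P + i) (P + j) \<le> \<tau> * (2 + real P * \<eta>)"
      using tdist_same_group[OF i j n] \<tau>(1) by (intro mult_left_mono) (simp_all add: dist_legs n)
    also note \<tau>(2)
    finally have "ereal (\<tau> * tdist T' (P + i) (P + j)) < ereal (2 * real t)" by simp
    moreover have "P + i \<in> leaves T" "P + j \<in> leaves T" using n by (auto simp: leaves_T)
    ultimately have "G.\<mu> (\<lambda>(x,y). tdist T' x y) (P + i) (P + j) < ereal (2 * real t)"
      using \<mu> le_less_trans by blast
    then obtain p where p: "G.awalk (P + i) p (P + j)"
      "G.awalk_cost (\<lambda>(x,y). tdist T' x y) p < 2 * real t"
      by (auto simp: G.\<mu>_def INF_less_iff)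
    have "(P + i, P + j) \<in> (parcs G \<inter> ?L \<times> ?L) ^^ length p \<and>
        2 * real (length p) \<le> G.awalk_cost (\<lambda>(x,y). tdist T' x y) p"
    proof (rule G.cheap_walk_hops[OF _ _ _ p(1) _ p(2)])
      show "0 \<le> (case e of (x, y) \<Rightarrow> tdist T' x y)" if "e \<in> parcs G" for e
      proof -
        obtain a b where e: "e = (a,b)" by (cases e)
        then have "a \<in> T'.V" "b \<in> T'.V" using that G.in_arcsD1 G.in_arcsD2 GV by blast+
        then show ?thesis using T'.tdist_nonneg by (simp add: e)
      qed
      show "P + i \<in> ?L" using i by simp
    next
      fix x y assume "x \<in> ?L" and y: "y \<in> pverts G" "y \<notin> ?L"
      then obtain a where a: "x = P + a" "a \<in> group g" by blast
      have an: "a < n" using less_n a gh by blast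
      show "2 * real t \<le> (case (x, y) of (x, y) \<Rightarrow> tdist T' x y)"
      proof (cases "y \<in> A")
        case True
        then show ?thesis using clean a by simp
      next
        case False
        then obtain b where b: "y = P + b" "b < n"
          using y G(2) by (auto simp: leaves_T dest!: le_Suc_ex)
        then have "b \<notin> group g" using y by blast
        then have "4 * real t \<le> tdist T x y" using tdist_other_group a an b by blast
        then show ?thesis using dist_legs an b by (simp add: a b)
      qed
    next
      fix x y assume "x \<in> ?L" "y \<in> ?L" "x \<noteq> y"
      then obtain a b where "x = P + a" "y = P + b" "a \<in> group g" "b \<in> group g" "a \<noteq> b" by blast
      then show "2 \<le> (case (x, y) of (x, y) \<Rightarrow> tdist T' x y)"
        using tdist_legs_ge less_n gh dist_legs by simp
    qed
    then have hops: "(P + i, P + j) \<in> (parcs G \<inter> ?L \<times> ?L) ^^ length p" and "length p < t"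
      using p(2) by auto
    have "(a,b) \<in> group_links G g ^^ l"
      if "(P + a, P + b) \<in> (parcs G \<inter> ?L \<times> ?L) ^^ l" for a b l
      using that
    proof (induction l arbitrary: b)
      case (Suc l)
      then obtain y where y: "(P + a, y) \<in> (parcs G \<inter> ?L \<times> ?L) ^^ l"
        "(y, P + b) \<in> parcs G \<inter> ?L \<times> ?L" by auto
      then obtain d where d: "y = P + d" "d \<in> group g" "b \<in> group g" by auto
      have "(a,d) \<in> group_links G g ^^ l" using Suc.IH y(1) d by simp
      moreover have "(d,b) \<in> group_links G g" using y(2) d by (simp add: group_links_def)
      ultimately show ?case by auto
    qed simp
    then show ?thesis using hops \<open>length p < t\<close> by blast
  qed
  ultimately show ?thesis by (intro exI[of _ H]) (auto simp: H_def)
qed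

text \<open>Groups are disjoint, so no arc is counted for two of them, and an arc of index
  difference \<open>d\<close> has at least \<open>M * d\<close> tree edges even before the Steiner
  points are placed.\<close>

lemma sum_span_length_le_complexity:
  assumes spanner: "steiner_spanner \<tau> T A T' G" and H: "H \<subseteq> {..<h}" "h * N \<le> n"
  shows "real M * (\<Sum>g\<in>H. span_length (group_links G g)) \<le> 2 * complexity T' G"
proof -
  have G: "pair_graph G" and place: "steiner_placement T A T'"
    using spanner by (auto simp: steiner_spanner_def)
  obtain c' where len: "\<And>x y. x \<in> V \<Longrightarrow> y \<in> V \<Longrightarrow>
      length (tpath T x y) \<le> length (tpath T' x y)"
    using steiner_placement_cut_tree[OF place cut_tree_axioms] by blast
  interpret G: pair_graph G by fact
  define F where "F = (\<lambda>g. (\<lambda>(i,j). (P + i, P + j)) ` group_links G g)"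
  have finH: "finite H" using H finite_subset by blast
  have inj: "inj_on (\<lambda>(i,j). (P + i, P + j)) S" for S :: "(nat \<times> nat) set"
    by (auto simp: inj_on_def)
  have one: "real M * span_length (group_links G g) \<le> (\<Sum>(p,q)\<in>F g. real (length (tpath T' p q)))"
    if "g \<in> H" for g
  proof -
    have gh: "g < h" using that H by auto
    have "real M * span_length (group_links G g) =
        (\<Sum>(i,j)\<in>group_links G g. real M * \<bar>real i - real j\<bar>)"
      by (simp add: span_length_def sum_distrib_left case_prod_unfold)
    also have "\<dots> \<le> (\<Sum>(i,j)\<in>group_links G g. real (length (tpath T' (P + i) (P + j))))"
    proof (rule sum_mono, clarify)
      fix i j assume "(i,j) \<in> group_links G g"
      then have n: "i < n" "j < n" using group_less[OF gh H(2)] by (auto simp: group_links_def)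
      show "real M * \<bar>real i - real j\<bar> \<le> real (length (tpath T' (P + i) (P + j)))"
        using length_tpath_legs_ge[OF n] len[of "P + i" "P + j"] leg_in_verts n by fastforce
    qed
    also have "\<dots> = (\<Sum>(p,q)\<in>F g. real (length (tpath T' p q)))"
      unfolding F_def by (subst sum.reindex[OF inj]) (simp add: case_prod_unfold)
    finally show ?thesis .
  qed
  have "real M * (\<Sum>g\<in>H. span_length (group_links G g)) \<le>
      (\<Sum>g\<in>H. \<Sum>(p,q)\<in>F g. real (length (tpath T' p q)))"
    unfolding sum_distrib_left by (intro sum_mono one)
  also have "\<dots> = (\<Sum>(p,q)\<in>(\<Union>g\<in>H. F g). real (length (tpath T' p q)))"
    using finH finite_group_links group_disjoint
    by (intro sum.UNION_disjoint[symmetric]) (auto simp: F_def group_links_def)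
  also have "\<dots> \<le> (\<Sum>(p,q)\<in>parcs G. real (length (tpath T' p q)))"
    using G.pair_finite_arcs by (intro sum_mono2) (auto simp: F_def group_links_def)
  also have "\<dots> = 2 * complexity T' G"
    by (simp add: complexity_def case_prod_unfold)
  finally show ?thesis .
qed

text \<open>Finite stretch alone forces the spanner to connect the first leaf with the last. This is
  the bound for bounded \<open>n / k\<close>.\<close>

lemma legs_hull_le_complexity:
  assumes spanner: "steiner_spanner \<tau> T A T' G"
  shows "real M * (real n - 1) \<le> 2 * complexity T' G"
proof -
  have G: "pair_graph G" "pverts G = leaves T \<union> A" and place: "steiner_placement T A T'"
    and \<mu>: "\<And>p q. p \<in> leaves T \<Longrightarrow> q \<in> leaves T \<Longrightarrow>
      wf_digraph.\<mu> (with_proj G) (\<lambda>(x,y). tdist T' x y) p q \<le> ereal (\<tau> * tdist T' p q)"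
    using spanner by (auto simp: steiner_spanner_def)
  obtain c' where T': "cut_tree T' c'" and V': "V \<union> A \<subseteq> pverts (tgraph T')"
    and len: "\<And>x y. x \<in> V \<Longrightarrow> y \<in> V \<Longrightarrow> length (tpath T x y) \<le> length (tpath T' x y)"
    using steiner_placement_cut_tree[OF place cut_tree_axioms] by blast
  let ?p = "P + 0" and ?q = "P + (n - 1)"
  have leaf: "?p \<in> leaves T" "?q \<in> leaves T" using pos by (auto simp: leaves_T)
  have V: "?p \<in> V" "?q \<in> V"
    using pos leg_in_verts[of 0] leg_in_verts[of "n - 1"] by auto
  have "real M * (real n - 1) = real M * \<bar>real 0 - real (n - 1)\<bar>"
    using pos by (simp add: of_nat_diff)
  also have "\<dots> \<le> real (length (tpath T ?p ?q))"
    using pos by (intro length_tpath_legs_ge) auto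
  also have "\<dots> \<le> real (length (tpath T' ?p ?q))" using len V by simp
  also have "\<dots> \<le> 2 * complexity T' G"
  proof (rule length_tpath_le_complexity[OF T' G(1)])
    show "pverts G \<subseteq> pverts (tgraph T')" using V' by (auto simp: G(2) leaves_def)
    show "wf_digraph.\<mu> (with_proj G) (\<lambda>(x,y). tdist T' x y) ?p ?q < \<infinity>"
      using \<mu>[OF leaf] by (rule le_less_trans) simp
  qed
  finally show ?thesis .
qed

end

section \<open>The lower bound\<close>

text \<open>Put \<open>Q = K * 2 ^ (t - 1)\<close>. If \<open>S < N\<close>, then
  \<open>bound\<close> would give \<open>N \<le> Q\<close>, against the size of \<open>N\<close>. So
  \<open>S + N \<le> 2 * S\<close>, and the ratio \<open>y = S / N\<close> satisfies
  \<open>N \<le> Q * y ^ (t - 1)\<close>. Because \<open>y \<ge> 1\<close>, the exponent may be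
  raised to \<open>t + 1\<close>, which leads to the root in the claim.\<close>

lemma span_lower_bound:
  fixes S x N K :: real and t :: nat
  assumes "1 \<le> K" "2 \<le> t" "K * 2 ^ (t - 1) + 1 \<le> N" "0 \<le> S"
    and bound: "N ^ t \<le> K * (S + N) ^ (t - 1)"
    and x: "0 < x" "x \<le> 4 * N"
  shows "N * x powr (1 / (real t + 1)) \<le> 4 * K * 2 ^ (t - 1) * S"
proof -
  obtain r where r: "t = Suc r" using assms(2) by (cases t) auto
  define Q where "Q = K * 2 ^ r"
  have Q: "1 \<le> Q" using assms(1) by (simp add: Q_def mult_ge1_I)
  have N: "Q + 1 \<le> N" using assms(3) by (simp add: Q_def r)
  have bound': "N ^ Suc r \<le> K * (S + N) ^ r" using bound by (simp add: r)
  have NS: "N \<le> S"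
  proof (rule ccontr)
    assume "\<not> N \<le> S"
    then have "K * (S + N) ^ r \<le> K * (2 * N) ^ r"
      using assms by (intro mult_left_mono power_mono) auto
    then have "N ^ r * N \<le> N ^ r * Q" using bound' by (simp add: Q_def power_mult_distrib mult_ac)
    then show False using N Q by simp
  qed
  have "N ^ Suc r \<le> K * (2 * S) ^ r"
    using bound' NS N Q assms(1) by (smt (verit) mult_left_mono power_mono)
  then have NQ: "N ^ r * N \<le> Q * S ^ r" by (simp add: Q_def power_mult_distrib mult_ac)
  define y where "y = S / N"
  have y: "1 \<le> y" using NS N Q by (simp add: y_def)
  have "N \<le> Q * y ^ r" using NQ N Q by (simp add: y_def power_divide field_simps)
  also have "\<dots> \<le> Q * y ^ (t + 1)" using y Q by (intro mult_left_mono power_increasing) (auto simp: r)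
  finally have "x \<le> (4 * Q) * y ^ (t + 1)" using x by linarith
  \<comment> \<open>Enlarging the constant makes the right-hand side a pure power, whose root is
    \<open>4 * Q * y\<close>.\<close>
  also have "\<dots> \<le> (4 * Q) ^ (t + 1) * y ^ (t + 1)"
    using Q y by (intro mult_right_mono self_le_power) auto
  also have "\<dots> = (4 * Q * y) powr (real t + 1)"
    using Q y powr_realpow[of "4 * Q * y" "t + 1"] by (simp add: power_mult_distrib add.commute)
  finally have "x powr (1 / (real t + 1)) \<le> ((4 * Q * y) powr (real t + 1)) powr (1 / (real t + 1))"
    using x by (intro powr_mono2) auto
  also have "\<dots> = 4 * Q * y" using Q y by (simp add: powr_powr)
  finally show ?thesis using N Q by (simp add: y_def Q_def r field_simps)
qed

theorem lemma5:
  fixes \<epsilon> :: real and t :: nat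
  assumes "0 < \<epsilon>" and "\<epsilon> < 1" and "2 \<le> t"
  shows "\<exists>c::real. \<exists>C::real. 0 < c \<and> 0 < C \<and>
    (\<forall>n m k::nat. 0 < n \<and> 0 < m \<and> 0 < k \<and> k < n \<and> C * real n \<le> real m \<longrightarrow>
      (\<exists>T::nat rtree. weighted_rooted_tree T \<and> card (leaves T) = n \<and>
         card (pverts (tgraph T)) = m \<and>
         (\<forall>A T' G. steiner_spanner (real t - \<epsilon>) T A T' G \<and> card A = k \<longrightarrow>
            c * (real m * real n powr (1 / (real t + 1)) / real k powr (1 / (real t + 1)))
              \<le> complexity T' G)))"
proof -
  obtain K0 where K0: "\<And>(E::(nat \<times> nat) set) X V. finite E \<Longrightarrow> finite X \<Longrightarrow> finite V \<Longrightarrow>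
     (\<forall>x\<in>X. \<exists>v\<in>V. \<exists>i\<le>t - 1. (x,v) \<in> E ^^ i) \<Longrightarrow>
     real (card X) ^ Suc (t - 1) \<le> K0 * (span_length E + real (card X)) ^ (t - 1) * real (card V)"
    using few_hops_span_length[of "t - 1"] by blast
  define K where "K = max 1 K0"
  define Q where "Q = K * 2 ^ (t - 1)"
  have K: "1 \<le> K" "K0 \<le> K" by (auto simp: K_def)
  have Q: "1 \<le> Q" using K by (simp add: Q_def mult_ge1_I)
  \<comment> \<open>In \<open>64 * Q\<close>, one factor \<open>8\<close> compares \<open>m\<close>
    with the complexity or with \<open>M * k * N\<close>; the remaining \<open>8 * Q\<close> bounds
    \<open>x powr \<alpha>\<close> for small groups and comes from the span bound for large
    ones.\<close>
  have main: "\<exists>T::nat rtree. weighted_rooted_tree T \<and> card (leaves T) = n \<and>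
         card (pverts (tgraph T)) = m \<and>
         (\<forall>A T' G. steiner_spanner (real t - \<epsilon>) T A T' G \<and> card A = k \<longrightarrow>
            1 / (64 * Q) * (real m * real n powr (1 / (real t + 1)) / real k powr (1 / (real t + 1)))
              \<le> complexity T' G)"
    if k: "0 < k" "k < n" and m: "4 * real n \<le> real m" for n m k :: nat
  proof -
    have n: "0 < n" "2 \<le> n" using k by auto
    have m': "4 * n \<le> m" using m by linarith
    \<comment> \<open>With \<open>n\<close> leaves this leaves exactly \<open>m - n\<close> spine
      vertices.\<close>
    define P where "P = m - n"
    define M where "M = P div n"
    define N' where "N' = n div (2 * k)"
    \<comment> \<open>There are \<open>2 * k\<close> groups, so that \<open>k\<close> Steiner points
      leave at least \<open>k\<close> unspoiled. The maximum only keeps group sizes positive when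
      \<open>n < 2 * k\<close>, which falls under the case of small groups.\<close>
    define N where "N = max 1 N'"
    \<comment> \<open>The light edges together weigh at most \<open>\<epsilon> / t\<close>, and
      \<open>(t - \<epsilon>) * (2 + \<epsilon> / t)\<close> is below \<open>2 * t\<close>, the
      price of \<open>t\<close> hops.\<close>
    define \<eta> where "\<eta> = \<epsilon> / (real t * real m)"
    define x where "x = real n / real k"
    define \<alpha> where "\<alpha> = 1 / (real t + 1)"
    have nM: "n * M \<le> P" by (simp add: M_def)
    have M_pos: "0 < M" using m' n by (simp add: M_def P_def div_greater_zero_iff)
    \<comment> \<open>The leaves and the remainder of the division account for fewer than
      \<open>2 * n\<close> vertices, at most half of \<open>m\<close>.\<close>
    have M_ge: "real m \<le> 2 * (real n * real M)"
    proof -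
      have "P < n * M + n"
        unfolding M_def using mod_less_divisor[OF n(1), of P] mult_div_mod_eq[of n P] by linarith
      then have "m < n * M + 2 * n" using m' by (simp add: P_def)
      then have "real m < real n * real M + 2 * real n" by (metis of_nat_less_iff of_nat_add of_nat_mult of_nat_numeral)
      then show ?thesis using m by linarith
    qed
    have foot: "j * M < P" if "j < n" for j
    proof -
      have "Suc j * M \<le> n * M" using that by (intro mult_le_mono1) simp
      then show ?thesis using nM M_pos by simp
    qed
    interpret clustered_caterpillar P n M N t \<eta>
      using foot n M_pos assms m' by unfold_locales (auto simp: N_def \<eta>_def)
    have "\<eta> * real P \<le> \<epsilon> / real t"
    proof -
      have "\<epsilon> * real P \<le> \<epsilon> * real m" using assms by (simp add: P_def)
      then show ?thesis using assms m' n by (simp add: \<eta>_def field_simps)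
    qed
    then have "(real t - \<epsilon>) * (2 + real P * \<eta>) \<le> (real t - \<epsilon>) * (2 + \<epsilon> / real t)"
      using assms by (intro mult_left_mono) (auto simp: mult.commute)
    also have "\<dots> = 2 * real t - \<epsilon> - \<epsilon> * \<epsilon> / real t"
      using assms by (simp add: field_simps)
    also have "\<dots> < 2 * real t"
    proof -
      have "0 \<le> \<epsilon> * \<epsilon> / real t" by simp
      then show ?thesis using assms(1) by linarith
    qed
    finally have \<tau>: "(real t - \<epsilon>) * (2 + real P * \<eta>) < 2 * real t" .
    have x: "1 \<le> x" using k by (simp add: x_def)
    have x_le: "x \<le> 2 * (real N' + 1)"
    proof -
      have "n < 2 * k * N' + 2 * k"
        unfolding N'_def using mod_less_divisor[of "2 * k" n] k mult_div_mod_eq[of "2 * k" n]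
        by linarith
      then have "real n < 2 * real k * real N' + 2 * real k"
        by (metis of_nat_less_iff of_nat_add of_nat_mult of_nat_numeral)
      then show ?thesis using k by (simp add: x_def field_simps)
    qed
    have "1 / (64 * Q) * (real m * real n powr \<alpha> / real k powr \<alpha>) \<le> complexity T' G"
      if spanner: "steiner_spanner (real t - \<epsilon>) T A T' G" and A: "card A = k" for A T' G
    proof -
      have eq: "real m * real n powr \<alpha> / real k powr \<alpha> = real m * x powr \<alpha>"
        unfolding x_def by (simp add: powr_divide)
      have "real m * x powr \<alpha> \<le> 64 * Q * complexity T' G"
      \<comment> \<open>For small groups \<open>x powr \<alpha>\<close> is at most a constant, and
        the path between the extreme leaves suffices. Otherwise the groups are large enough for
        \<open>span_lower_bound\<close>.\<close>
      proof (cases "real N' < Q + 1")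
        case True
        have "real m \<le> 2 * (real n * real M)" by (rule M_ge)
        also have "\<dots> \<le> 4 * (real M * (real n - 1))" using n M_pos by (simp add: algebra_simps)
        also have "\<dots> \<le> 8 * complexity T' G" using legs_hull_le_complexity[OF spanner] by simp
        finally have mc: "real m \<le> 8 * complexity T' G" .
        have "x powr \<alpha> \<le> x powr 1" using x by (intro powr_mono) (auto simp: \<alpha>_def)
        also have "\<dots> \<le> 8 * Q" using x x_le True Q by simp
        finally have "x powr \<alpha> \<le> 8 * Q" .
        then have "real m * x powr \<alpha> \<le> (8 * complexity T' G) * (8 * Q)"
          using mc by (intro mult_mono) auto
        then show ?thesis by (simp add: mult_ac)
      next
        case False
        then have N': "Q + 1 \<le> real N'" by simp
        then have N_eq: "N = N'" using Q by (auto simp: N_def)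
        have hN: "2 * k * N \<le> n" unfolding N_eq N'_def by (simp add: mult.commute)
        have finA: "finite A" using A k by (metis card.infinite less_numeral_extra(3))
        have "0 \<le> real t - \<epsilon>" using assms by linarith
        from clean_groups[OF spanner finA this \<tau> hN] obtain H where H: "H \<subseteq> {..<2 * k}"
          "2 * k \<le> card H + card A"
          "\<And>g i j. g \<in> H \<Longrightarrow> i \<in> group g \<Longrightarrow> j \<in> group g \<Longrightarrow> \<exists>l<t. (i,j) \<in> group_links G g ^^ l"
          by blast
        have x4: "x \<le> 4 * real N" using x_le N' Q by (simp add: N_eq)
        have each: "real N * x powr \<alpha> \<le> 4 * Q * span_length (group_links G g)" if g: "g \<in> H" for g
        proof -
          let ?S = "span_length (group_links G g)"
          have cg: "card (group g) = N" and fg: "finite (group g)" by (auto simp: group_def)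
          \<comment> \<open>All leaves of the group reach its first one, so the hop bound applies
            with a singleton as target set.\<close>
          have center: "g * N \<in> group g" using pos by (simp add: group_def)
          have "\<forall>i\<in>group g. \<exists>v\<in>{g * N}. \<exists>l\<le>t - 1. (i,v) \<in> group_links G g ^^ l"
          proof
            fix i assume "i \<in> group g"
            then obtain l where "l < t" "(i, g * N) \<in> group_links G g ^^ l"
              using H(3)[OF g _ center] by blast
            then show "\<exists>v\<in>{g * N}. \<exists>l\<le>t - 1. (i,v) \<in> group_links G g ^^ l"
              by (intro bexI[of _ "g * N"] exI[of _ l]) auto
          qed
          from K0[OF finite_group_links fg _ this]
          have "real N ^ t \<le> K0 * (?S + real N) ^ (t - 1)"
            using assms by (simp add: cg)
          also have "\<dots> \<le> K * (?S + real N) ^ (t - 1)"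
            using K span_length_nonneg[of "group_links G g"] by (intro mult_right_mono) auto
          finally have "real N ^ t \<le> K * (?S + real N) ^ (t - 1)" .
          from span_lower_bound[OF K(1) assms(3) _ span_length_nonneg this _ x4]
          show ?thesis using x N' by (simp add: Q_def N_eq \<alpha>_def mult_ac)
        qed
        have "real k * (real N * x powr \<alpha>) \<le> real (card H) * (real N * x powr \<alpha>)"
          using H(2) A by (intro mult_right_mono) auto
        also have "\<dots> = (\<Sum>g\<in>H. real N * x powr \<alpha>)" by simp
        also have "\<dots> \<le> (\<Sum>g\<in>H. 4 * Q * span_length (group_links G g))"
          by (intro sum_mono each)
        also have "\<dots> = 4 * Q * (\<Sum>g\<in>H. span_length (group_links G g))"
          by (simp add: sum_distrib_left)
        finally have "real M * (real k * (real N * x powr \<alpha>))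
            \<le> real M * (4 * Q * (\<Sum>g\<in>H. span_length (group_links G g)))"
          by (intro mult_left_mono) auto
        also have "\<dots> = 4 * Q * (real M * (\<Sum>g\<in>H. span_length (group_links G g)))"
          by (simp add: mult_ac)
        also have "\<dots> \<le> 4 * Q * (2 * complexity T' G)"
          using sum_span_length_le_complexity[OF spanner H(1) hN] Q by (intro mult_left_mono) auto
        finally have c: "(real M * (real k * real N)) * x powr \<alpha> \<le> 8 * Q * complexity T' G"
          by (simp add: mult_ac)
        have "real n \<le> 4 * (real k * real N)" using x4 k by (simp add: x_def field_simps)
        then have "real M * real n \<le> real M * (4 * (real k * real N))" by (intro mult_left_mono) auto
        then have "real m \<le> 8 * (real M * (real k * real N))" using M_ge by (simp add: mult_ac)
        then have "real m * x powr \<alpha> \<le> 8 * (real M * (real k * real N)) * x powr \<alpha>"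
          by (intro mult_right_mono) auto
        then show ?thesis using c by (simp add: mult_ac)
      qed
      then show ?thesis unfolding eq using Q by (simp add: field_simps)
    qed
    moreover have "card (leaves T) = n" by (simp add: leaves_T)
    moreover have "card (pverts (tgraph T)) = m"
      unfolding verts_T using m' by (simp add: P_def)
    ultimately show ?thesis using weighted_rooted_tree_T unfolding \<alpha>_def by blast
  qed
  show ?thesis
    using main Q by (intro exI[of _ "1 / (64 * Q)"] exI[of _ 4]) auto
qed

end
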